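(* Let $(B_t)_{t\ge 0}$ be a standard Brownian motion in $\mathbb{R}^d$, $d\geq 1$. Let $A$ be a non-empty subset of $[0,1]$ and let $f:[0,1]\to\mathbb{R}^d$ be a càdlàg function. Then, almost surely, $$\overline{\dim}_M (B+f)(A) \geq \max\{\overline{\dim}_M B(A),\ \overline{\dim}_M f(A)\}$$ and $$\underline{\dim}_M (B+f)(A) \geq \max\{\underline{\dim}_M B(A),\ \underline{\dim}_M f(A)\}.$$
   Context: For a function $h$ on $[0,1]$ and $A\subseteq[0,1]$, $h(A)=\{h(t):t\in A\}$ denotes the image; $(B+f)(t)=B_t+f(t)$. For a non-empty bounded set $E\subset\mathbb{R}^m$ and $\epsilon>0$, let $P(E,\epsilon)$ be the maximum number of pairwise disjoint balls of radius $\epsilon$ with centers in $E$. The upper and lower Minkowski (box) dimensions of $E$ are $$\overline{\dim}_M(E)=\limsup_{\epsilon\to 0}\frac{\log P(E,\epsilon)}{\log \epsilon^{-1}},\qquad \underline{\dim}_M(E)=\liminf_{\epsilon\to 0}\frac{\log P(E,\epsilon)}{\log \epsilon^{-1}}.$$ *)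

theory Defs
  imports "HOL-Probability.Probability"
begin

(* Only meaningful for non-empty bounded E and eps > 0: then the set of cardinalities below is
   finite and contains 1.  A family of balls is given by its set of centers; balls are open. *)
definition packing_number :: "'a::metric_space set \<Rightarrow> real \<Rightarrow> nat" where
  "packing_number E \<epsilon> =
     Max {card C | C. C \<subseteq> E \<and> finite C \<and> disjoint_family_on (\<lambda>x. ball x \<epsilon>) C}"

definition upper_minkowski_dim :: "'a::metric_space set \<Rightarrow> ereal" where
  "upper_minkowski_dim E =
     Limsup (at_right 0) (\<lambda>\<epsilon>. ereal (ln (real (packing_number E \<epsilon>)) / ln (inverse \<epsilon>)))"

definition lower_minkowski_dim :: "'a::metric_space set \<Rightarrow> ereal" where
  "lower_minkowski_dim E =
     Liminf (at_right 0) (\<lambda>\<epsilon>. ereal (ln (real (packing_number E \<epsilon>)) / ln (inverse \<epsilon>)))"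

(* Values of f outside [a,b] are irrelevant. *)
definition cadlag_on :: "real \<Rightarrow> real \<Rightarrow> (real \<Rightarrow> 'a::topological_space) \<Rightarrow> bool" where
  "cadlag_on a b f \<longleftrightarrow>
     (\<forall>t\<in>{a..<b}. (f \<longlongrightarrow> f t) (at_right t)) \<and>
     (\<forall>t\<in>{a<..b}. \<exists>l. (f \<longlongrightarrow> l) (at_left t))"

(* The time index is real, but only B t with t \<ge> 0 is constrained.  The product of
   one-dimensional densities is the density of the centred Gaussian vector with covariance
   (t - s) times the identity. *)
locale standard_brownian_motion = prob_space M
  for M :: "'w measure" and B :: "real \<Rightarrow> 'w \<Rightarrow> real ^ 'd" +
  assumes random_variable_BM: "\<And>t. 0 \<le> t \<Longrightarrow> random_variable borel (B t)"
    and start_zero: "AE \<omega> in M. B 0 \<omega> = 0"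
    and indep_increments: "\<And>(n::nat) t. 0 \<le> t 0 \<Longrightarrow> (\<And>i. i < n \<Longrightarrow> t i \<le> t (Suc i)) \<Longrightarrow>
          indep_vars (\<lambda>_. borel) (\<lambda>i \<omega>. B (t (Suc i)) \<omega> - B (t i) \<omega>) {..<n}"
    and gaussian_increments: "\<And>s t. 0 \<le> s \<Longrightarrow> s < t \<Longrightarrow>
          distributed M lborel (\<lambda>\<omega>. B t \<omega> - B s \<omega>)
            (\<lambda>x. ennreal (\<Prod>i\<in>UNIV. normal_density 0 (sqrt (t - s)) (x $ i)))"
    and continuous_paths: "AE \<omega> in M. continuous_on {0..} (\<lambda>t. B t \<omega>)"

end

theory Submission
  imports Defs "HOL-Real_Asymp.Real_Asymp"
begin

text \<open>Write \<open>Y = B + f\<close> and \<open>\<epsilon> = (1/2) ^ n\<close>, and let \<open>g\<close> map a finite set \<open>T\<close> of times in \<open>A\<close> onto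
  an \<open>\<epsilon>\<close>-packing.  If \<open>Y s\<close> and \<open>Y t\<close> are within \<open>8 * \<epsilon>\<close> of each other with probability at most
  \<open>L * (\<epsilon> / dist (g s) (g t)) ^ d\<close>, then, counting the points of the packing in dyadic annuli, the
  expected number of such pairs is of order \<open>L * n * card T\<close>.  By Markov, Borel--Cantelli and
  Cauchy--Schwarz the packing number of \<open>Y ` A\<close> is almost surely at least \<open>card T\<close>, up to a
  subexponential factor in \<open>n\<close> and the factor \<open>L\<close>.

  For \<open>g = f\<close> the probability bound holds with constant \<open>L\<close>, because the Gaussian density of any
  variance is at most a multiple of \<open>norm x\<close>^(-d).  For the comparison with \<open>B ` A\<close> take for \<open>g\<close> one
  fixed path, which maximises the packing number among the paths with a given Hoelder constant
  and exponent \<open>\<gamma> < 1/2\<close>.  There the bound \<open>(\<epsilon> / sqrt \<bar>s - t\<bar>) ^ d\<close> gives it with an \<open>L\<close> of small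
  exponential growth as \<open>\<gamma>\<close> tends to 1/2.\<close>

subsection \<open>Packing numbers\<close>

text \<open>Volume comparison: the disjoint balls all lie in the ball of radius
  \<open>R + \<epsilon>\<close> about \<open>z\<close>.\<close>

lemma card_packing_le:
  fixes C :: "'a::euclidean_space set"
  assumes "finite C" and disj: "disjoint_family_on (\<lambda>x. ball x \<epsilon>) C"
    and sub: "C \<subseteq> cball z R" and "\<epsilon> > 0" and "R \<ge> 0"
  shows "real (card C) \<le> ((R + \<epsilon>) / \<epsilon>) ^ DIM('a)"
proof -
  define v where "v = unit_ball_vol (real DIM('a))"
  have v: "v > 0"
    unfolding v_def by simp
  have "real (card C) * (v * \<epsilon> ^ DIM('a)) = (\<Sum>x\<in>C. measure lborel (ball x \<epsilon>))"
    using \<open>\<epsilon> > 0\<close> by (simp add: content_ball v_def)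
  also have "\<dots> = measure lborel (\<Union>x\<in>C. ball x \<epsilon>)"
    using disj \<open>finite C\<close>
    by (intro measure_finite_Union[symmetric]) (use emeasure_lborel_ball_finite in \<open>auto simp: less_top\<close>)
  also have "\<dots> \<le> measure lborel (cball z (R + \<epsilon>))"
  proof (rule measure_mono_fmeasurable)
    show "(\<Union>x\<in>C. ball x \<epsilon>) \<subseteq> cball z (R + \<epsilon>)"
    proof
      fix y assume "y \<in> (\<Union>x\<in>C. ball x \<epsilon>)"
      then obtain x where x: "x \<in> C" "dist x y < \<epsilon>" by auto
      then have "dist z x \<le> R" using sub by auto
      then show "y \<in> cball z (R + \<epsilon>)"
        using x(2) dist_triangle[of z y x] by simp
    qed
  qed (use emeasure_lborel_cball_finite in \<open>auto simp: fmeasurable_def intro!: borel_open\<close>)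
  also have "\<dots> = v * (R + \<epsilon>) ^ DIM('a)"
    using assms by (simp add: content_cball v_def)
  finally have "real (card C) * \<epsilon> ^ DIM('a) \<le> (R + \<epsilon>) ^ DIM('a)"
    using v by (simp add: algebra_simps)
  then show ?thesis
    using \<open>\<epsilon> > 0\<close> by (simp add: power_divide field_simps)
qed

text \<open>\<open>Max\<close> in \<open>packing_number\<close> carries information only for a
  finite set; the volume bound is uniform over all packings of a bounded set.\<close>

lemma finite_packing_cards:
  fixes E :: "'a::euclidean_space set"
  assumes "bounded E" "\<epsilon> > 0"
  shows "finite {card C | C. C \<subseteq> E \<and> finite C \<and> disjoint_family_on (\<lambda>x. ball x \<epsilon>) C}"
proof -
  obtain R where R: "E \<subseteq> cball 0 R"
    using bounded_subset_ballD[OF assms(1), of 0] ball_subset_cball by (metis order_trans)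
  have "card C \<le> nat \<lfloor>((max 0 R + \<epsilon>) / \<epsilon>) ^ DIM('a)\<rfloor>"
    if "C \<subseteq> E" "finite C" "disjoint_family_on (\<lambda>x. ball x \<epsilon>) C" for C
  proof -
    have "C \<subseteq> cball 0 (max 0 R)"
      using that R by fastforce
    from card_packing_le[OF that(2,3) this \<open>\<epsilon> > 0\<close>] show ?thesis
      by (simp add: le_nat_floor)
  qed
  then show ?thesis
    by (intro finite_subset[OF _ finite_atMost[of "nat \<lfloor>((max 0 R + \<epsilon>) / \<epsilon>) ^ DIM('a)\<rfloor>"]]) auto
qed

lemma card_le_packing_number:
  fixes E :: "'a::euclidean_space set"
  assumes "bounded E" "\<epsilon> > 0"
    and "C \<subseteq> E" "finite C" "disjoint_family_on (\<lambda>x. ball x \<epsilon>) C"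
  shows "card C \<le> packing_number E \<epsilon>"
  unfolding packing_number_def
  by (rule Max_ge[OF finite_packing_cards[OF assms(1,2)]]) (use assms(3-) in blast)

lemma packing_number_attained:
  fixes E :: "'a::euclidean_space set"
  assumes "bounded E" "\<epsilon> > 0"
  obtains C where "C \<subseteq> E" "finite C" "disjoint_family_on (\<lambda>x. ball x \<epsilon>) C"
    "card C = packing_number E \<epsilon>"
proof -
  have "packing_number E \<epsilon> \<in>
      {card C | C. C \<subseteq> E \<and> finite C \<and> disjoint_family_on (\<lambda>x. ball x \<epsilon>) C}"
    unfolding packing_number_def
    by (rule Max_in[OF finite_packing_cards[OF assms]])
      (auto intro!: exI[of _ "{}"] simp: disjoint_family_on_def)
  then show ?thesis using that by auto
qed

lemma packing_number_ge_1:
  fixes E :: "'a::euclidean_space set"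
  assumes "bounded E" "\<epsilon> > 0" "E \<noteq> {}"
  shows "packing_number E \<epsilon> \<ge> 1"
proof -
  obtain x where "x \<in> E" using assms(3) by blast
  then show ?thesis
    using card_le_packing_number[OF assms(1,2), of "{x}"] by (simp add: disjoint_family_on_def)
qed

lemma packing_number_antimono:
  fixes E :: "'a::euclidean_space set"
  assumes "bounded E" "0 < \<epsilon>" "\<epsilon> \<le> \<delta>"
  shows "packing_number E \<delta> \<le> packing_number E \<epsilon>"
proof -
  obtain C where C: "C \<subseteq> E" "finite C" "disjoint_family_on (\<lambda>x. ball x \<delta>) C"
    "card C = packing_number E \<delta>"
    using packing_number_attained[OF assms(1), of \<delta>] assms by auto
  have "disjoint_family_on (\<lambda>x. ball x \<epsilon>) C"
    using C(3) subset_ball[OF assms(3)] unfolding disjoint_family_on_def by blast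
  then show ?thesis
    using card_le_packing_number[OF assms(1,2) C(1,2)] C(4) by simp
qed

text \<open>At a smaller distance \<open>y\<close> would lie in both balls. Separation by \<epsilon>
  holds in every metric space, whereas \<open>2 * \<epsilon>\<close> may fail.\<close>

lemma disjoint_balls_dist:
  assumes "disjoint_family_on (\<lambda>x. ball x \<epsilon>) C" "x \<in> C" "y \<in> C" "x \<noteq> y" "\<epsilon> > 0"
  shows "\<epsilon> \<le> dist x y"
proof (rule ccontr)
  assume "\<not> \<epsilon> \<le> dist x y"
  then have "y \<in> ball x \<epsilon> \<inter> ball y \<epsilon>"
    using assms by simp
  then show False
    using assms unfolding disjoint_family_on_def by blast
qed

text \<open>The points of a maximal packing of \<open>y ` T\<close> split \<open>T\<close> into at most \<open>packing_number E r\<close> classes, and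
  indices in the same class form close pairs; conclude with Cauchy--Schwarz.\<close>
lemma card_squared_le_close_pairs:
  fixes y :: "'i \<Rightarrow> 'a::euclidean_space"
  assumes "finite T" "y ` T \<subseteq> E" "bounded E" "r > 0"
  shows "(card T)\<^sup>2 \<le> card {(s, t) \<in> T \<times> T. dist (y s) (y t) < 4 * r} * packing_number E r"
proof -
  obtain C where C: "C \<subseteq> y ` T" "finite C" "disjoint_family_on (\<lambda>x. ball x r) C"
    "card C = packing_number (y ` T) r"
    using packing_number_attained[of "y ` T" r] assms by (auto simp: bounded_subset)
  have "\<exists>c\<in>C. dist c (y t) < 2 * r" if "t \<in> T" for t
  proof (rule ccontr)
    assume "\<not> ?thesis"
    then have far: "2 * r \<le> dist c (y t)" if "c \<in> C" for c
      using that by (auto simp: not_less)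
    then have "y t \<notin> C"
      using \<open>r > 0\<close> by fastforce
    have "ball c r \<inter> ball (y t) r = {}" if "c \<in> C" for c
    proof (rule ccontr)
      assume "\<not> ?thesis"
      then obtain z where "dist c z < r" "dist (y t) z < r" by auto
      then show False
        using far[OF that] dist_triangle2[of c "y t" z] by linarith
    qed
    then have "disjoint_family_on (\<lambda>x. ball x r) (insert (y t) C)"
      using C(3) unfolding disjoint_family_on_def by blast
    then have "card (insert (y t) C) \<le> card C"
      unfolding C(4) using C assms that
      by (intro card_le_packing_number) (auto intro: bounded_subset)
    then show False
      using \<open>y t \<notin> C\<close> C(2) by simp
  qed
  then obtain c where c: "\<And>t. t \<in> T \<Longrightarrow> c t \<in> C \<and> dist (c t) (y t) < 2 * r"
    by metis
  define F where "F x = {t \<in> T. c t = x}" for x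
  have F: "finite (F x)" for x
    using assms(1) by (simp add: F_def)
  have "card T = (\<Sum>x\<in>C. card (F x))"
    using sum.group[of T C c "\<lambda>_. 1::nat"] assms(1) C(2) c by (simp add: F_def image_subset_iff)
  then have "(real (card T))\<^sup>2 \<le> (\<Sum>x\<in>C. (real (card (F x)))\<^sup>2) * real (card C)"
    using sum_squared_le_sum_of_squares[of "\<lambda>x. real (card (F x))" C] by simp
  also have "(\<Sum>x\<in>C. (real (card (F x)))\<^sup>2) = real (\<Sum>x\<in>C. card (F x \<times> F x))"
    by (simp add: power2_eq_square card_cartesian_product)
  also have "(\<Sum>x\<in>C. card (F x \<times> F x)) = card (\<Union>x\<in>C. F x \<times> F x)"
    using C(2) F by (intro card_UN_disjoint[symmetric]) (auto simp: F_def)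
  finally have "(card T)\<^sup>2 \<le> card (\<Union>x\<in>C. F x \<times> F x) * card C"
    by (simp flip: of_nat_power of_nat_mult)
  also have "\<dots> \<le> card {(s, t) \<in> T \<times> T. dist (y s) (y t) < 4 * r} * packing_number E r"
  proof (rule mult_mono)
    have "dist (y s) (y t) < 4 * r" if "s \<in> T" "t \<in> T" "c s = c t" for s t
      using c[OF that(1)] c[OF that(2)] that(3) dist_triangle3[of "y s" "y t" "c t"] by auto
    then have "(\<Union>x\<in>C. F x \<times> F x) \<subseteq> {(s, t) \<in> T \<times> T. dist (y s) (y t) < 4 * r}"
      by (auto simp: F_def)
    then show "card (\<Union>x\<in>C. F x \<times> F x) \<le> card {(s, t) \<in> T \<times> T. dist (y s) (y t) < 4 * r}"
      using finite_subset[of "{(s, t) \<in> T \<times> T. dist (y s) (y t) < 4 * r}" "T \<times> T"] assms(1)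
      by (intro card_mono) auto
    show "card C \<le> packing_number E r"
      using C assms by (intro card_le_packing_number) auto
  qed auto
  finally show ?thesis .
qed

text \<open>With d the dimension, the volume bound allows of order \<open>2 ^ (k * d)\<close>
  centers at distance about \<open>2 ^ k * \<epsilon>\<close> from \<open>x\<close>, and each
  contributes at most \<open>(1 / 2 ^ k) ^ d\<close>. So every dyadic annulus contributes at most a
  constant, and \<open>m\<close> annuli suffice.\<close>

lemma sum_packing_dist_powers_le:
  fixes C :: "'a::euclidean_space set"
  assumes "finite C" and disj: "disjoint_family_on (\<lambda>x. ball x \<epsilon>) C" and "\<epsilon> > 0" and "x \<in> C"
    and diam: "\<And>y. y \<in> C \<Longrightarrow> dist x y < 2 ^ m * \<epsilon>"
  shows "(\<Sum>y\<in>C - {x}. (\<epsilon> / dist x y) ^ DIM('a)) \<le> 4 ^ DIM('a) * real m"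
proof -
  define S where "S k = {y \<in> C. 2 ^ k * \<epsilon> \<le> dist x y \<and> dist x y < 2 ^ Suc k * \<epsilon>}" for k :: nat
  have S: "(\<Sum>y\<in>S k. (\<epsilon> / dist x y) ^ DIM('a)) \<le> 4 ^ DIM('a)" for k
  proof -
    have fin: "finite (S k)"
      using \<open>finite C\<close> by (simp add: S_def)
    have "(\<Sum>y\<in>S k. (\<epsilon> / dist x y) ^ DIM('a)) \<le> (\<Sum>y\<in>S k. (1 / 2 ^ k) ^ DIM('a))"
    proof (intro sum_mono power_mono)
      fix y assume "y \<in> S k"
      then have "2 ^ k * \<epsilon> \<le> dist x y" by (simp add: S_def)
      moreover from this have "dist x y > 0"
        using \<open>\<epsilon> > 0\<close> by (smt (verit) mult_pos_pos zero_less_power)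
      ultimately show "\<epsilon> / dist x y \<le> 1 / 2 ^ k"
        by (simp add: field_simps)
    qed (use \<open>\<epsilon> > 0\<close> in auto)
    also have "\<dots> = real (card (S k)) * (1 / 2 ^ k) ^ DIM('a)"
      by simp
    also have "\<dots> \<le> ((2 ^ Suc k * \<epsilon> + \<epsilon>) / \<epsilon>) ^ DIM('a) * (1 / 2 ^ k) ^ DIM('a)"
    proof (intro mult_right_mono card_packing_le[OF fin])
      show "disjoint_family_on (\<lambda>x. ball x \<epsilon>) (S k)"
        using disj by (rule disjoint_family_on_mono[rotated]) (auto simp: S_def)
      show "S k \<subseteq> cball x (2 ^ Suc k * \<epsilon>)"
        by (auto simp: S_def)
    qed (use \<open>\<epsilon> > 0\<close> in auto)
    also have "\<dots> = ((2 ^ Suc k + 1) / 2 ^ k) ^ DIM('a)"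
    proof -
      have "(2 ^ Suc k * \<epsilon> + \<epsilon>) / \<epsilon> = 2 ^ Suc k + 1"
        using \<open>\<epsilon> > 0\<close> by (simp add: field_simps)
      then show ?thesis
        by (simp only:) (simp add: power_divide)
    qed
    also have "\<dots> \<le> 4 ^ DIM('a)"
    proof (intro power_mono)
      have "(1::real) \<le> 2 ^ k" by simp
      then have "2 * (2::real) ^ k + 1 \<le> 4 * 2 ^ k" by linarith
      then show "(2 ^ Suc k + 1) / 2 ^ k \<le> (4::real)"
        by (simp add: divide_le_eq)
    qed auto
    finally show ?thesis .
  qed
  \<comment> \<open>The index of the annulus containing \<open>y\<close>. Annuli start at
    \<open>k = 0\<close> because distinct centers are at least \<epsilon> apart, and end before
    \<open>m\<close> by \<open>diam\<close>.\<close>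
  define \<kappa> where "\<kappa> y = (LEAST k. dist x y < 2 ^ Suc k * \<epsilon>)" for y
  have \<kappa>: "y \<in> S (\<kappa> y)" "\<kappa> y < m" if y: "y \<in> C - {x}" for y
  proof -
    have ge: "2 ^ 0 * \<epsilon> \<le> dist x y"
      using disjoint_balls_dist[OF disj \<open>x \<in> C\<close>, of y] y \<open>\<epsilon> > 0\<close> by auto
    have "m \<noteq> 0"
      using ge diam[of y] y by (intro notI) auto
    then obtain m' where m': "m = Suc m'"
      using not0_implies_Suc by blast
    have P: "dist x y < 2 ^ Suc m' * \<epsilon>"
      using diam[of y] y m' by auto
    have 1: "dist x y < 2 ^ Suc (\<kappa> y) * \<epsilon>"
      unfolding \<kappa>_def by (rule LeastI[where P = "\<lambda>k. dist x y < 2 ^ Suc k * \<epsilon>", OF P])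
    have "\<kappa> y \<le> m'"
      unfolding \<kappa>_def by (rule Least_le[where P = "\<lambda>k. dist x y < 2 ^ Suc k * \<epsilon>", OF P])
    then show "\<kappa> y < m"
      by (simp add: m')
    have "2 ^ \<kappa> y * \<epsilon> \<le> dist x y"
    proof (cases "\<kappa> y")
      case (Suc j)
      then have "\<not> dist x y < 2 ^ Suc j * \<epsilon>"
        using not_less_Least[of j "\<lambda>k. dist x y < 2 ^ Suc k * \<epsilon>"] by (simp add: \<kappa>_def)
      then show ?thesis by (simp add: Suc)
    qed (use ge in simp)
    then show "y \<in> S (\<kappa> y)"
      using y 1 by (simp add: S_def)
  qed
  have "(\<Sum>y\<in>C - {x}. (\<epsilon> / dist x y) ^ DIM('a))
      = (\<Sum>k<m. \<Sum>y\<in>{y \<in> C - {x}. \<kappa> y = k}. (\<epsilon> / dist x y) ^ DIM('a))"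
    using \<open>finite C\<close> \<kappa>(2) by (intro sum.group[symmetric]) auto
  also have "\<dots> \<le> (\<Sum>k<m. \<Sum>y\<in>S k. (\<epsilon> / dist x y) ^ DIM('a))"
    using \<open>finite C\<close> \<open>\<epsilon> > 0\<close> \<kappa>(1) by (intro sum_mono sum_mono2) (auto simp: S_def)
  also have "\<dots> \<le> (\<Sum>k<m. 4 ^ DIM('a))"
    by (intro sum_mono S)
  finally show ?thesis
    by (simp add: mult.commute)
qed

subsection \<open>Comparison of Minkowski dimensions\<close>

text \<open>Every small \<epsilon> satisfies
  \<open>(1/2) ^ n \<le> \<epsilon> < 2 * (1/2) ^ n\<close> for some \<open>n\<close>. Packing
  numbers decrease in the radius, so \<open>E\<close> is compared at the smaller scale and
  \<open>Y\<close> at the larger one; hence the doubled radius for \<open>Y\<close> in the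
  hypothesis.\<close>

lemma log_packing_ratio_le:
  fixes E Y :: "'a::euclidean_space set" and \<delta> :: real
  assumes "bounded E" "bounded Y" "E \<noteq> {}" "Y \<noteq> {}" "\<delta> > 0"
    and ev: "\<forall>\<^sub>F n in sequentially.
      real (packing_number E ((1/2) ^ n)) \<le> 2 powr (\<delta> * n) * packing_number Y (2 * (1/2) ^ n)"
  shows "\<forall>\<^sub>F \<epsilon> in at_right 0. ln (real (packing_number E \<epsilon>)) / ln (inverse \<epsilon>)
      \<le> ln (real (packing_number Y \<epsilon>)) / ln (inverse \<epsilon>) + 2 * \<delta>"
proof -
  obtain N where N: "\<And>n. n \<ge> N \<Longrightarrow>
      real (packing_number E ((1/2) ^ n)) \<le> 2 powr (\<delta> * n) * packing_number Y (2 * (1/2) ^ n)"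
    using ev by (auto simp: eventually_sequentially)
  \<comment> \<open>The bound \<open>1/2\<close> makes \<open>ln (inverse \<epsilon>)\<close>
    positive and \<open>n\<close> nonzero; the bound \<open>(1/2) ^ N\<close> forces
    \<open>n \<ge> N\<close>.\<close>
  have *: "ln (real (packing_number E \<epsilon>)) / ln (inverse \<epsilon>)
      \<le> ln (real (packing_number Y \<epsilon>)) / ln (inverse \<epsilon>) + 2 * \<delta>"
    if \<epsilon>: "0 < \<epsilon>" "\<epsilon> < min (1/2) ((1/2) ^ N)" for \<epsilon> :: real
  proof -
    define n where "n = (LEAST n. (1/2) ^ n \<le> \<epsilon>)"
    obtain n0 where "(1/2) ^ n0 < \<epsilon>"
      using real_arch_pow_inv[of \<epsilon> "1/2"] \<epsilon> by auto
    then have n: "(1/2) ^ n \<le> \<epsilon>"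
      unfolding n_def by (intro LeastI[of "\<lambda>n. (1/2) ^ n \<le> \<epsilon>" n0]) auto
    have "n \<noteq> 0"
      using n \<epsilon> by (intro notI) auto
    then obtain k where k: "n = Suc k"
      using not0_implies_Suc by blast
    then have "\<not> (1/2) ^ k \<le> \<epsilon>"
      using not_less_Least[of k "\<lambda>n. (1/2) ^ n \<le> \<epsilon>"] by (simp add: n_def)
    then have n': "\<epsilon> < 2 * (1/2) ^ n"
      by (simp add: k)
    have "(1/2) ^ n < ((1/2) ^ N :: real)"
      using n \<epsilon> by linarith
    then have "n \<ge> N"
      by (simp add: power_strict_decreasing_iff)
    have pos: "packing_number E \<epsilon> \<ge> 1" "packing_number Y \<epsilon> \<ge> 1"
      using packing_number_ge_1[OF assms(1) \<epsilon>(1) assms(3)]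
        packing_number_ge_1[OF assms(2) \<epsilon>(1) assms(4)] by simp_all
    have "real (packing_number E \<epsilon>) \<le> packing_number E ((1/2) ^ n)"
      using packing_number_antimono[OF assms(1) _ n] by simp
    also have "\<dots> \<le> 2 powr (\<delta> * n) * packing_number Y (2 * (1/2) ^ n)"
      using N[OF \<open>n \<ge> N\<close>] .
    also have "\<dots> \<le> 2 powr (\<delta> * n) * packing_number Y \<epsilon>"
      using packing_number_antimono[OF assms(2) \<epsilon>(1), of "2 * (1/2) ^ n"] n' by simp
    finally have "ln (real (packing_number E \<epsilon>)) \<le> ln (2 powr (\<delta> * n) * packing_number Y \<epsilon>)"
      using pos by simp
    also have "\<dots> = \<delta> * (n * ln 2) + ln (real (packing_number Y \<epsilon>))"
      using pos by (simp add: ln_mult ln_powr)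
    \<comment> \<open>Since \<open>\<epsilon> < 1/2\<close> and
      \<open>\<epsilon> / 2 < (1/2) ^ n\<close>, also
      \<open>\<epsilon> * \<epsilon> \<le> (1/2) ^ n\<close>. This is the source of the factor 2 in
      \<open>2 * \<delta>\<close>.\<close>
    also have "n * ln 2 \<le> 2 * ln (inverse \<epsilon>)"
    proof -
      have "\<epsilon> * \<epsilon> \<le> \<epsilon> * (1/2)"
        using \<epsilon> by (intro mult_left_mono) auto
      also have "\<dots> \<le> (1/2) ^ n"
        using n' by simp
      finally have "ln (\<epsilon> * \<epsilon>) \<le> ln ((1/2) ^ n)"
        using \<epsilon> by (subst ln_le_cancel_iff) auto
      then show ?thesis
        using \<epsilon> by (simp add: ln_mult ln_realpow ln_inverse ln_div)
    qed
    finally have "ln (real (packing_number E \<epsilon>))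
        \<le> \<delta> * (2 * ln (inverse \<epsilon>)) + ln (real (packing_number Y \<epsilon>))"
      using \<open>\<delta> > 0\<close> by simp
    moreover have "ln (inverse \<epsilon>) > 0"
      using \<epsilon> by (intro ln_gt_zero) (auto simp: field_simps)
    ultimately show ?thesis
      by (simp add: field_simps)
  qed
  show ?thesis
    unfolding eventually_at_right_field
    by (rule exI[of _ "min (1/2) ((1/2) ^ N)"]) (use * in auto)
qed

text \<open>The error in the logarithmic ratios is an arbitrarily small constant, which can be
  pulled out of \<open>Limsup\<close> and \<open>Liminf\<close>.\<close>

lemma minkowski_dim_le:
  fixes E Y :: "'a::euclidean_space set"
  assumes "bounded E" "bounded Y" "E \<noteq> {}" "Y \<noteq> {}"
    and ev: "\<And>\<delta>::real. \<delta> > 0 \<Longrightarrow> \<forall>\<^sub>F n in sequentially.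
      real (packing_number E ((1/2) ^ n)) \<le> 2 powr (\<delta> * n) * packing_number Y (2 * (1/2) ^ n)"
  shows upper_minkowski_dim_le: "upper_minkowski_dim E \<le> upper_minkowski_dim Y"
    and lower_minkowski_dim_le: "lower_minkowski_dim E \<le> lower_minkowski_dim Y"
proof -
  define e where "e \<epsilon> = ln (real (packing_number E \<epsilon>)) / ln (inverse \<epsilon>)" for \<epsilon>
  define y where "y \<epsilon> = ln (real (packing_number Y \<epsilon>)) / ln (inverse \<epsilon>)" for \<epsilon>
  have le: "\<forall>\<^sub>F \<epsilon> in at_right 0. ereal (e \<epsilon>) \<le> ereal (y \<epsilon>) + ereal \<delta>" if "\<delta> > 0" for \<delta>
    using log_packing_ratio_le[OF assms(1-4), of "\<delta> / 2"] ev[of "\<delta> / 2"] that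
    by (simp add: e_def y_def)
  have nt: "at_right (0::real) \<noteq> bot"
    by simp
  show "upper_minkowski_dim E \<le> upper_minkowski_dim Y"
    unfolding upper_minkowski_dim_def e_def[symmetric] y_def[symmetric]
  proof (rule ereal_le_epsilon2)
    fix \<delta> :: real assume "0 < \<delta>"
    have "Limsup (at_right 0) (\<lambda>\<epsilon>. ereal (e \<epsilon>)) \<le> Limsup (at_right 0) (\<lambda>\<epsilon>. ereal (y \<epsilon>) + ereal \<delta>)"
      by (rule Limsup_mono[OF le[OF \<open>0 < \<delta>\<close>]])
    also have "\<dots> = Limsup (at_right 0) (\<lambda>\<epsilon>. ereal (y \<epsilon>)) + ereal \<delta>"
      by (rule Limsup_add_ereal_right[OF nt]) simp
    finally show "Limsup (at_right 0) (\<lambda>\<epsilon>. ereal (e \<epsilon>)) \<le> Limsup (at_right 0) (\<lambda>\<epsilon>. ereal (y \<epsilon>)) + ereal \<delta>" .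
  qed
  show "lower_minkowski_dim E \<le> lower_minkowski_dim Y"
    unfolding lower_minkowski_dim_def e_def[symmetric] y_def[symmetric]
  proof (rule ereal_le_epsilon2)
    fix \<delta> :: real assume "0 < \<delta>"
    have "Liminf (at_right 0) (\<lambda>\<epsilon>. ereal (e \<epsilon>)) \<le> Liminf (at_right 0) (\<lambda>\<epsilon>. ereal (y \<epsilon>) + ereal \<delta>)"
      by (rule Liminf_mono[OF le[OF \<open>0 < \<delta>\<close>]])
    also have "\<dots> = Liminf (at_right 0) (\<lambda>\<epsilon>. ereal (y \<epsilon>)) + ereal \<delta>"
      by (rule Liminf_add_ereal_right[OF nt]) simp
    finally show "Liminf (at_right 0) (\<lambda>\<epsilon>. ereal (e \<epsilon>)) \<le> Liminf (at_right 0) (\<lambda>\<epsilon>. ereal (y \<epsilon>)) + ereal \<delta>" .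
  qed
qed

text \<open>One-sided limits bound \<open>f\<close> on either side of each point, and bisection
  extends this to the whole interval. Applied to the drift, it gives meaning to the packing numbers
  of its image.\<close>

lemma cadlag_on_bounded:
  fixes f :: "real \<Rightarrow> 'a::real_normed_vector"
  assumes "cadlag_on a b f" "a \<le> b"
  shows "bounded (f ` {a..b})"
proof -
  have nhd: "\<exists>d>0. bounded (f ` ({x - d<..<x + d} \<inter> {a..b}))" if x: "a \<le> x" "x \<le> b" for x
  proof -
    have right: "\<exists>d>0. bounded (f ` ({x<..<x + d} \<inter> {a..b}))"
    proof (cases "x = b")
      case False
      then have "(f \<longlongrightarrow> f x) (at_right x)"
        using assms x by (auto simp: cadlag_on_def)
      then have "\<forall>\<^sub>F t in at_right x. dist (f t) (f x) < 1"
        by (rule tendstoD) simp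
      then obtain c where "c > x" "\<And>t. x < t \<Longrightarrow> t < c \<Longrightarrow> dist (f t) (f x) < 1"
        by (auto simp: eventually_at_right_field)
      then have "f ` ({x<..<x + (c - x)} \<inter> {a..b}) \<subseteq> ball (f x) 1" "c - x > 0"
        by (auto simp: dist_commute)
      then show ?thesis
        using bounded_subset[OF bounded_ball] by blast
    next
      case True
      then have "{x<..<x + 1} \<inter> {a..b} = {}" by auto
      then show ?thesis
        by (metis bounded_empty image_empty zero_less_one)
    qed
    have left: "\<exists>d>0. bounded (f ` ({x - d<..<x} \<inter> {a..b}))"
    proof (cases "x = a")
      case False
      then have "x \<in> {a<..b}"
        using x by simp
      then obtain l where "(f \<longlongrightarrow> l) (at_left x)"
        using assms(1) unfolding cadlag_on_def by blast
      then have "\<forall>\<^sub>F t in at_left x. dist (f t) l < 1"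
        by (rule tendstoD) simp
      then obtain c where "c < x" "\<And>t. c < t \<Longrightarrow> t < x \<Longrightarrow> dist (f t) l < 1"
        by (auto simp: eventually_at_left_field)
      then have "f ` ({x - (x - c)<..<x} \<inter> {a..b}) \<subseteq> ball l 1" "x - c > 0"
        by (auto simp: dist_commute)
      then show ?thesis
        using bounded_subset[OF bounded_ball] by blast
    next
      case True
      then have "{x - 1<..<x} \<inter> {a..b} = {}" by auto
      then show ?thesis
        by (metis bounded_empty image_empty zero_less_one)
    qed
    obtain d1 where d1: "d1 > 0" "bounded (f ` ({x<..<x + d1} \<inter> {a..b}))"
      using right by blast
    obtain d2 where d2: "d2 > 0" "bounded (f ` ({x - d2<..<x} \<inter> {a..b}))"
      using left by blast
    \<comment> \<open>The one-sided neighbourhoods omit \<open>x\<close> itself, so the value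
      \<open>f x\<close> is added separately.\<close>
    have "bounded (insert (f x) (f ` ({x<..<x + d1} \<inter> {a..b}) \<union> f ` ({x - d2<..<x} \<inter> {a..b})))"
      using d1 d2 by simp
    moreover have "f ` ({x - min d1 d2<..<x + min d1 d2} \<inter> {a..b})
      \<subseteq> insert (f x) (f ` ({x<..<x + d1} \<inter> {a..b}) \<union> f ` ({x - d2<..<x} \<inter> {a..b}))"
    proof (rule image_subsetI)
      fix t assume t: "t \<in> {x - min d1 d2<..<x + min d1 d2} \<inter> {a..b}"
      consider "t = x" | "x < t" | "t < x" by linarith
      then show "f t \<in> insert (f x) (f ` ({x<..<x + d1} \<inter> {a..b}) \<union> f ` ({x - d2<..<x} \<inter> {a..b}))"
        using t by cases (auto intro!: imageI)
    qed
    ultimately show ?thesis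
      using d1 d2 bounded_subset by (metis min_less_iff_conj)
  qed
  \<comment> \<open>Bisection: a property of intervals that survives concatenation and holds for all
    short intervals around each point holds for \<open>{a..b}\<close>. The intersection takes care
    of short intervals that leave \<open>{a..b}\<close>.\<close>
  have "bounded (f ` ({a..b} \<inter> {a..b}))"
  proof (rule Bolzano[where P = "\<lambda>u v. bounded (f ` ({u..v} \<inter> {a..b}))", OF \<open>a \<le> b\<close>])
    fix u v w
    assume trans: "bounded (f ` ({u..v} \<inter> {a..b}))" "bounded (f ` ({v..w} \<inter> {a..b}))" "u \<le> v" "v \<le> w"
    have "{u..w} \<inter> {a..b} = ({u..v} \<inter> {a..b}) \<union> ({v..w} \<inter> {a..b})"
      using trans(3,4) by auto
    then have "f ` ({u..w} \<inter> {a..b}) = f ` ({u..v} \<inter> {a..b}) \<union> f ` ({v..w} \<inter> {a..b})"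
      by (simp only: image_Un)
    then show "bounded (f ` ({u..w} \<inter> {a..b}))"
      using trans(1,2) by (simp only: bounded_Un)
  next
    fix x assume "a \<le> x" "x \<le> b"
    then obtain d where d: "d > 0" "bounded (f ` ({x - d<..<x + d} \<inter> {a..b}))"
      using nhd by blast
    then show "\<exists>d>0. \<forall>u v. u \<le> x \<and> x \<le> v \<and> v - u < d \<longrightarrow> bounded (f ` ({u..v} \<inter> {a..b}))"
      by (intro exI[of _ d]) (auto intro!: bounded_subset[OF d(2)] image_mono)
  qed
  then show ?thesis by simp
qed

subsection \<open>Gaussian estimates\<close>

text \<open>\<open>h\<close> is the variance of each coordinate. With \<open>h = t - s\<close> this
  is literally the density in \<open>gaussian_increments\<close>.\<close>

abbreviation gauss_density :: "real \<Rightarrow> real ^ 'd \<Rightarrow> real" where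
  "gauss_density h x \<equiv> (\<Prod>i\<in>UNIV. normal_density 0 (sqrt h) (x $ i))"

lemma gauss_density_eq:
  fixes x :: "real ^ 'd"
  assumes "h > 0"
  shows "gauss_density h x = (1 / sqrt (2 * pi * h)) ^ CARD('d) * exp (- (norm x)\<^sup>2 / (2 * h))"
proof -
  have "(norm x)\<^sup>2 = (\<Sum>i\<in>UNIV. (x $ i)\<^sup>2)"
    unfolding power2_norm_eq_inner inner_vec_def by (simp add: power2_eq_square)
  then have "exp (- (norm x)\<^sup>2 / (2 * h)) = (\<Prod>i\<in>UNIV. exp (- (x $ i)\<^sup>2 / (2 * h)))"
    by (simp add: exp_sum[symmetric] sum_negf sum_divide_distrib)
  then show ?thesis
    using assms by (simp add: normal_density_def prod_dividef power_divide)
qed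

lemma gauss_density_le:
  fixes x :: "real ^ 'd"
  assumes "h > 0"
  shows "gauss_density h x \<le> (1 / sqrt h) ^ CARD('d) * exp (- (norm x)\<^sup>2 / (2 * h))"
proof -
  have "1 * h \<le> (2 * pi) * h"
    using assms pi_gt3 by (intro mult_right_mono) auto
  then have "1 / sqrt (2 * pi * h) \<le> 1 / sqrt h"
    using assms by (intro divide_left_mono) auto
  then show ?thesis
    unfolding gauss_density_eq[OF assms] using assms
    by (intro mult_right_mono power_mono) auto
qed

lemma (in prob_space) prob_ball_le:
  fixes X :: "'a \<Rightarrow> 'b::euclidean_space"
  assumes X: "distributed M lborel X (\<lambda>x. ennreal (g x))"
    and D: "\<And>x. x \<in> ball c r \<Longrightarrow> g x \<le> D" and "D \<ge> 0" "r \<ge> 0"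
  shows "prob {\<omega> \<in> space M. dist (X \<omega>) c < r} \<le> D * (unit_ball_vol (real DIM('b)) * r ^ DIM('b))"
proof -
  have *: "{\<omega> \<in> space M. dist (X \<omega>) c < r} = X -` ball c r \<inter> space M"
    by (auto simp: dist_commute)
  have "emeasure M (X -` ball c r \<inter> space M) = (\<integral>\<^sup>+x. ennreal (g x) * indicator (ball c r) x \<partial>lborel)"
    by (rule distributed_emeasure[OF X]) simp
  also have "\<dots> \<le> (\<integral>\<^sup>+x. ennreal D * indicator (ball c r) x \<partial>lborel)"
    using D by (intro nn_integral_mono) (auto simp: indicator_def intro!: ennreal_leI)
  also have "\<dots> = ennreal D * emeasure lborel (ball c r)"
    by (simp add: nn_integral_cmult_indicator)
  also have "\<dots> = ennreal (D * (unit_ball_vol (real DIM('b)) * r ^ DIM('b)))"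
    using assms by (simp add: emeasure_ball ennreal_mult)
  finally show ?thesis
    unfolding * using assms by (simp add: emeasure_eq_measure)
qed

text \<open>Used with \<open>y = norm c / sqrt h\<close>, where a bound independent of
  \<open>h\<close> is needed. The constant comes from \<open>(1 + x / n) ^ n \<le> exp x\<close> at
  \<open>x = y\<^sup>2 / 8\<close> together with
  \<open>y ^ n \<le> 1 + (y\<^sup>2) ^ n\<close>.\<close>

lemma power_mult_exp_neg_square_le:
  fixes y :: real
  assumes "y \<ge> 0" "n > 0"
  shows "y ^ n * exp (- y\<^sup>2 / 8) \<le> 1 + (8 * real n) ^ n"
proof -
  have "(y\<^sup>2 / (8 * n)) ^ n \<le> (1 + y\<^sup>2 / 8 / n) ^ n"
    by (intro power_mono) auto
  also have "\<dots> \<le> exp (y\<^sup>2 / 8)"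
    using \<open>n > 0\<close> by (intro exp_ge_one_plus_x_over_n_power_n) (auto intro: order_trans[of _ 0])
  finally have 1: "(y\<^sup>2) ^ n \<le> (8 * real n) ^ n * exp (y\<^sup>2 / 8)"
    using \<open>n > 0\<close> by (simp add: power_divide field_simps)
  have "y ^ n \<le> 1 + (y\<^sup>2) ^ n"
  proof (cases "y \<le> 1")
    case True
    then show ?thesis
      using assms power_le_one[of y n] by (smt (verit) zero_le_power zero_le_power2)
  next
    case False
    then have "y ^ n \<le> (y\<^sup>2) ^ n"
      by (intro power_mono) (auto simp: power2_eq_square)
    then show ?thesis by simp
  qed
  also have "\<dots> \<le> exp (y\<^sup>2 / 8) + (8 * real n) ^ n * exp (y\<^sup>2 / 8)"
    using 1 by (intro add_mono) auto
  also have "\<dots> = (1 + (8 * real n) ^ n) * exp (y\<^sup>2 / 8)"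
    by (simp add: algebra_simps)
  finally show ?thesis
    by (simp add: exp_minus divide_simps)
qed

text \<open>Uniform in the variance: for \<open>r\<close> small against \<open>norm c\<close>, the density on the ball is at most
  \<open>h\<close>^(-d/2) exp(-\<open>norm c\<close>^2 / (8h)), whose supremum over \<open>h > 0\<close> is of order
  \<open>norm c\<close>^(-d).\<close>
lemma (in prob_space) prob_gauss_ball_le:
  fixes X :: "'a \<Rightarrow> real ^ 'd"
  assumes X: "distributed M lborel X (\<lambda>x. ennreal (gauss_density h x))"
    and "h > 0" "r > 0" "c \<noteq> 0"
  shows "prob {\<omega> \<in> space M. dist (X \<omega>) c < r}
    \<le> (2 ^ CARD('d) + unit_ball_vol (real CARD('d)) * (1 + (8 * real CARD('d)) ^ CARD('d)))
        * (r / norm c) ^ CARD('d)"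
    (is "?P \<le> (_ + ?V * ?C) * _")
proof (cases "norm c \<le> 2 * r")
  case True
  \<comment> \<open>Here \<open>r / norm c\<close> is at least 1/2, so the trivial bound suffices;
    it accounts for the summand \<open>2 ^ CARD('d)\<close>.\<close>
  have "?P \<le> 1 ^ CARD('d)" by simp
  also have "\<dots> \<le> (2 * (r / norm c)) ^ CARD('d)"
    using True assms by (intro power_mono) (auto simp: field_simps)
  also have "\<dots> \<le> (2 ^ CARD('d) + ?V * ?C) * (r / norm c) ^ CARD('d)"
    unfolding power_mult_distrib using assms by (intro mult_right_mono) auto
  finally show ?thesis .
next
  case False
  have "?P \<le> ?C / norm c ^ CARD('d) * (unit_ball_vol (real DIM(real ^ 'd)) * r ^ DIM(real ^ 'd))"
  proof (rule prob_ball_le[OF X])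
    fix x :: "real ^ 'd" assume "x \<in> ball c r"
    then have "norm c \<le> 2 * norm x"
      using False norm_triangle_ineq2[of c x] by (simp add: dist_norm)
    then have "(norm c)\<^sup>2 \<le> (2 * norm x)\<^sup>2"
      by (intro power_mono) auto
    then have *: "- (norm x)\<^sup>2 / (2 * h) \<le> - (norm c / sqrt h)\<^sup>2 / 8"
      using \<open>h > 0\<close> by (simp add: power_divide field_simps)
    have "gauss_density h x \<le> (1 / sqrt h) ^ CARD('d) * exp (- (norm x)\<^sup>2 / (2 * h))"
      by (rule gauss_density_le) fact
    also have "\<dots> \<le> (1 / sqrt h) ^ CARD('d) * exp (- (norm c / sqrt h)\<^sup>2 / 8)"
      using * \<open>h > 0\<close> by (intro mult_left_mono) auto
    \<comment> \<open>A power of \<open>norm c\<close> is inserted so that \<open>h\<close> occurs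
      only through the ratio \<open>norm c / sqrt h\<close>.\<close>
    also have "\<dots> = (norm c / sqrt h) ^ CARD('d) * exp (- (norm c / sqrt h)\<^sup>2 / 8) / norm c ^ CARD('d)"
      using \<open>h > 0\<close> \<open>c \<noteq> 0\<close> by (simp add: power_divide)
    also have "\<dots> \<le> ?C / norm c ^ CARD('d)"
      using \<open>h > 0\<close> by (intro divide_right_mono power_mult_exp_neg_square_le) auto
    finally show "gauss_density h x \<le> ?C / norm c ^ CARD('d)" .
  qed (use assms in auto)
  also have "\<dots> = (?V * ?C) * (r / norm c) ^ CARD('d)"
    by (simp add: power_divide)
  also have "\<dots> \<le> (2 ^ CARD('d) + ?V * ?C) * (r / norm c) ^ CARD('d)"
    using assms by (intro mult_right_mono) auto
  finally show ?thesis .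
qed

text \<open>Bounding the density by a constant gives an estimate uniform in the center
  \<open>c\<close>, and hence in the drift.\<close>

lemma (in prob_space) prob_gauss_ball_le_sqrt:
  fixes X :: "'a \<Rightarrow> real ^ 'd"
  assumes X: "distributed M lborel X (\<lambda>x. ennreal (gauss_density h x))"
    and "h > 0" "r > 0"
  shows "prob {\<omega> \<in> space M. dist (X \<omega>) c < r} \<le> unit_ball_vol (real CARD('d)) * (r / sqrt h) ^ CARD('d)"
proof -
  have "prob {\<omega> \<in> space M. dist (X \<omega>) c < r}
      \<le> (1 / sqrt h) ^ CARD('d) * (unit_ball_vol (real DIM(real ^ 'd)) * r ^ DIM(real ^ 'd))"
  proof (rule prob_ball_le[OF X])
    fix x :: "real ^ 'd"
    have "gauss_density h x \<le> (1 / sqrt h) ^ CARD('d) * exp (- (norm x)\<^sup>2 / (2 * h))"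
      by (rule gauss_density_le) fact
    also have "\<dots> \<le> (1 / sqrt h) ^ CARD('d) * 1"
      using \<open>h > 0\<close> by (intro mult_left_mono) auto
    finally show "gauss_density h x \<le> (1 / sqrt h) ^ CARD('d)" by simp
  qed (use assms in auto)
  then show ?thesis
    by (simp add: power_divide)
qed

text \<open>Halving the exponent in the density leaves a multiple of the density of variance \<open>2 * h\<close>,
  which has mass one.\<close>
lemma (in prob_space) prob_gauss_tail_le:
  fixes X Y :: "'a \<Rightarrow> real ^ 'd"
  assumes X: "distributed M lborel X (\<lambda>x. ennreal (gauss_density h x))"
    and Y: "distributed M lborel Y (\<lambda>x. ennreal (gauss_density (2 * h) x))"
    and "h > 0" "a \<ge> 0"
  shows "prob {\<omega> \<in> space M. a \<le> norm (X \<omega>)} \<le> sqrt 2 ^ CARD('d) * exp (- a\<^sup>2 / (4 * h))"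
proof -
  let ?D = "sqrt 2 ^ CARD('d) * exp (- a\<^sup>2 / (4 * h))"
  have *: "{\<omega> \<in> space M. a \<le> norm (X \<omega>)} = X -` {x. a \<le> norm x} \<inter> space M"
    by auto
  have "closed {x :: real ^ 'd. a \<le> norm x}"
    by (intro closed_Collect_le continuous_intros)
  then have m: "{x :: real ^ 'd. a \<le> norm x} \<in> sets lborel"
    by simp
  have "emeasure M (X -` {x. a \<le> norm x} \<inter> space M)
      = (\<integral>\<^sup>+(x :: real ^ 'd). ennreal (gauss_density h x) * indicator {x. a \<le> norm x} x \<partial>lborel)"
    by (rule distributed_emeasure[OF X m])
  also have "\<dots> \<le> (\<integral>\<^sup>+(x :: real ^ 'd). ennreal (gauss_density (2 * h) x) * ennreal ?D \<partial>lborel)"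
  proof (rule nn_integral_mono)
    fix x :: "real ^ 'd"
    show "ennreal (gauss_density h x) * indicator {x. a \<le> norm x} x
        \<le> ennreal (gauss_density (2 * h) x) * ennreal ?D"
    proof (cases "a \<le> norm x")
      case True
      then have "a\<^sup>2 \<le> (norm x)\<^sup>2"
        using \<open>a \<ge> 0\<close> by (intro power_mono)
      then have 1: "- (norm x)\<^sup>2 / (2 * h) \<le> - (norm x)\<^sup>2 / (2 * (2 * h)) + - a\<^sup>2 / (4 * h)"
        using \<open>h > 0\<close> by (simp add: field_simps)
      \<comment> \<open>Doubling the variance costs a factor \<open>sqrt 2\<close> per coordinate in
        the normalization.\<close>
      have 2: "1 / sqrt (2 * pi * h) = 1 / sqrt (2 * pi * (2 * h)) * sqrt 2"
      proof -
        have "2 * pi * (2 * h) = (2 * pi * h) * 2" by simp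
        then have "sqrt (2 * pi * (2 * h)) = sqrt (2 * pi * h) * sqrt 2"
          by (simp only: real_sqrt_mult)
        then show ?thesis by simp
      qed
      have "gauss_density h x \<le> (1 / sqrt (2 * pi * h)) ^ CARD('d)
          * exp (- (norm x)\<^sup>2 / (2 * (2 * h)) + - a\<^sup>2 / (4 * h))"
        unfolding gauss_density_eq[OF \<open>h > 0\<close>] using 1 \<open>h > 0\<close> by (intro mult_left_mono) auto
      also have "\<dots> = gauss_density (2 * h) x * ?D"
        unfolding gauss_density_eq[OF mult_pos_pos[OF zero_less_numeral \<open>h > 0\<close>]] 2 exp_add power_mult_distrib
        by (simp only: mult_ac)
      finally have "ennreal (gauss_density h x) \<le> ennreal (gauss_density (2 * h) x * ?D)"
        by (rule ennreal_leI)
      then show ?thesis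
        using True by (simp add: ennreal_mult prod_nonneg)
    qed simp
  qed
  \<comment> \<open>The existence of \<open>Y\<close> shows that the density of variance
    \<open>2 * h\<close> has total mass one.\<close>
  also have "\<dots> = (\<integral>\<^sup>+\<omega>. ennreal ?D \<partial>M)"
    by (rule distributed_nn_integral[OF Y]) simp
  also have "\<dots> = ennreal ?D"
    by (simp add: emeasure_space_1)
  finally show ?thesis
    unfolding * by (simp add: emeasure_eq_measure)
qed

subsection \<open>Hoelder continuity of Brownian paths\<close>

text \<open>Chaining along the dyadic floors of \<open>s\<close>: successive floors agree or are
  neighbours at the finer level, so a geometric series bounds the total increment from level
  \<open>m\<close> on, and continuity reaches \<open>s\<close> itself.\<close>

lemma dyadic_approximation_le:
  fixes g :: "real \<Rightarrow> 'a::real_normed_vector"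
  assumes cont: "continuous_on {0..1} g" and q: "0 < q" "q < 1" and "K \<ge> 0"
    and incr: "\<And>k j. j < 2 ^ k \<Longrightarrow> norm (g (real (Suc j) / 2 ^ k) - g (real j / 2 ^ k)) \<le> K * q ^ k"
    and s: "s \<in> {0..1}"
  shows "norm (g s - g (real (nat \<lfloor>2 ^ m * s\<rfloor>) / 2 ^ m)) \<le> K * q ^ m / (1 - q)"
proof -
  define j where "j k = nat \<lfloor>2 ^ k * s\<rfloor>" for k :: nat
  define u where "u k = real (j k) / 2 ^ k" for k
  have j: "real (j k) = of_int \<lfloor>2 ^ k * s\<rfloor>" for k
    using s by (simp add: j_def)
  have u: "u k \<le> s" "s - (1/2) ^ k \<le> u k" for k
  proof -
    have "(2 ^ k * s - 1) / 2 ^ k \<le> of_int \<lfloor>2 ^ k * s\<rfloor> / 2 ^ k" "of_int \<lfloor>2 ^ k * s\<rfloor> / 2 ^ k \<le> 2 ^ k * s / 2 ^ k"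
      using floor_correct[of "2 ^ k * s"] by (intro divide_right_mono; simp)+
    then show "u k \<le> s" "s - (1/2) ^ k \<le> u k"
      unfolding u_def j by (simp_all add: diff_divide_distrib power_divide)
  qed
  have u01: "u k \<in> {0..1}" for k
  proof -
    have "0 \<le> u k" by (simp add: u_def)
    then show ?thesis using u(1)[of k] s by simp
  qed
  have step: "norm (g (u (Suc k)) - g (u k)) \<le> K * q ^ Suc k" for k
  proof -
    \<comment> \<open>Passing to the next level appends one binary digit.\<close>
    have "\<lfloor>2 ^ Suc k * s\<rfloor> = 2 * \<lfloor>2 ^ k * s\<rfloor> \<or> \<lfloor>2 ^ Suc k * s\<rfloor> = 2 * \<lfloor>2 ^ k * s\<rfloor> + 1"
      using floor_correct[of "2 ^ k * s"] floor_correct[of "2 ^ Suc k * s"] by simp linarith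
    then have "real (j (Suc k)) = real (2 * j k) \<or> real (j (Suc k)) = real (2 * j k + 1)"
      unfolding of_nat_add of_nat_mult j by auto
    then consider "j (Suc k) = 2 * j k" | "j (Suc k) = Suc (2 * j k)"
      by linarith
    then show ?thesis
    proof cases
      case 1
      then have "u (Suc k) = u k" by (simp add: u_def)
      then show ?thesis using q \<open>K \<ge> 0\<close> by simp
    next
      case 2
      have "real (j (Suc k)) \<le> 2 ^ Suc k"
        using u01[of "Suc k"] by (simp add: u_def field_simps)
      then have "real (Suc (2 * j k)) \<le> real (2 ^ Suc k)"
        unfolding 2 by simp
      then have "2 * j k < 2 ^ Suc k"
        by linarith
      from incr[OF this] show ?thesis
        by (simp add: u_def 2)
    qed
  qed
  \<comment> \<open>The right side is a partial geometric sum beginning with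
    \<open>K * q ^ m\<close>. The steps themselves begin one power later, and the estimate gives
    that power away.\<close>
  have sum_le: "norm (g (u (m + n)) - g (u m)) \<le> K * q ^ m * (1 - q ^ n) / (1 - q)" for n
  proof (induction n)
    case (Suc n)
    have "norm (g (u (m + Suc n)) - g (u m))
        \<le> norm (g (u (Suc (m + n))) - g (u (m + n))) + norm (g (u (m + n)) - g (u m))"
      using norm_triangle_ineq[of "g (u (Suc (m + n))) - g (u (m + n))" "g (u (m + n)) - g (u m)"]
      by simp
    also have "\<dots> \<le> K * q ^ Suc (m + n) + K * q ^ m * (1 - q ^ n) / (1 - q)"
      by (intro add_mono step Suc.IH)
    also have "\<dots> \<le> K * q ^ (m + n) + K * q ^ m * (1 - q ^ n) / (1 - q)"
      using q \<open>K \<ge> 0\<close> by (intro add_mono mult_left_mono power_decreasing) auto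
    also have "\<dots> = K * q ^ m * (1 - q ^ Suc n) / (1 - q)"
      using q by (simp add: field_simps power_add)
    finally show ?case .
  qed simp
  have lim: "(\<lambda>n. g (u (m + n))) \<longlonglongrightarrow> g s"
  proof -
    have "u \<longlonglongrightarrow> s"
    proof (rule tendsto_sandwich[of "\<lambda>k. s - (1/2) ^ k" _ _ "\<lambda>_. s"])
      show "(\<lambda>k. s - (1/2) ^ k) \<longlonglongrightarrow> s"
        by real_asymp
    qed (use u in auto)
    then have "(\<lambda>n. u (m + n)) \<longlonglongrightarrow> s"
      using LIMSEQ_ignore_initial_segment[of u s m] by (simp add: add.commute)
    then show ?thesis
      by (rule continuous_on_tendsto_compose[OF cont]) (use s u01 in auto)
  qed
  have "norm (g s - g (u m)) \<le> K * q ^ m / (1 - q)"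
  proof (rule LIMSEQ_le_const2)
    show "(\<lambda>n. norm (g (u (m + n)) - g (u m))) \<longlonglongrightarrow> norm (g s - g (u m))"
      by (intro tendsto_intros lim)
    have "K * q ^ m * (1 - q ^ n) / (1 - q) \<le> K * q ^ m / (1 - q)" for n
    proof -
      have "K * q ^ m * (1 - q ^ n) \<le> K * q ^ m * 1"
        using q \<open>K \<ge> 0\<close> by (intro mult_left_mono) auto
      then show ?thesis
        using q by (intro divide_right_mono) auto
    qed
    then show "\<exists>N. \<forall>n\<ge>N. norm (g (u (m + n)) - g (u m)) \<le> K * q ^ m / (1 - q)"
      using sum_le order_trans by blast
  qed
  then show ?thesis
    by (simp add: u_def j_def)
qed

text \<open>The deterministic half of the Kolmogorov--Chentsov argument. For
  \<open>(1/2) ^ Suc m < t - s \<le> (1/2) ^ m\<close> the level \<open>m\<close> floors of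
  \<open>s\<close> and \<open>t\<close> agree or are adjacent, so one dyadic increment and two
  chains lead from \<open>s\<close> to \<open>t\<close>.\<close>

lemma dyadic_chaining:
  fixes g :: "real \<Rightarrow> 'a::real_normed_vector"
  assumes cont: "continuous_on {0..1} g" and "\<gamma> > 0" and "K \<ge> 0"
    and incr: "\<And>k j. j < 2 ^ k \<Longrightarrow>
      norm (g (real (Suc j) / 2 ^ k) - g (real j / 2 ^ k)) \<le> K * (2 powr - \<gamma>) ^ k"
  shows "\<exists>L. \<forall>s\<in>{0..1}. \<forall>t\<in>{0..1}. norm (g s - g t) \<le> L * \<bar>s - t\<bar> powr \<gamma>"
proof -
  define q where "q = 2 powr - \<gamma>"
  have q: "0 < q" "q < 1"
    using \<open>\<gamma> > 0\<close> by (auto simp: q_def powr_less_one)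
  \<comment> \<open>The summand 1 is for the middle increment, \<open>2 / (1 - q)\<close> for the
    two chains. Division by \<open>q\<close> turns \<open>q ^ m\<close> into
    \<open>q ^ Suc m\<close>, which lies below \<open>(t - s) powr \<gamma>\<close>.\<close>
  define L where "L = K * (1 + 2 / (1 - q)) / q"
  have main: "norm (g t - g s) \<le> L * (t - s) powr \<gamma>" if st: "s \<in> {0..1}" "t \<in> {0..1}" "s < t" for s t
  proof -
    define m where "m = (LEAST m. (1/2) ^ Suc m < t - s)"
    obtain m0 where "(1/2) ^ m0 < t - s"
      using real_arch_pow_inv[of "t - s" "1/2"] st by auto
    moreover have "(1/2) ^ Suc m0 \<le> ((1/2) ^ m0 :: real)"
      by (intro power_decreasing) auto
    ultimately have m0: "(1/2) ^ Suc m0 < t - s"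
      by linarith
    have m1: "(1/2) ^ Suc m < t - s"
      unfolding m_def by (rule LeastI[where P = "\<lambda>m. (1/2) ^ Suc m < t - s", OF m0])
    have m2: "t - s \<le> (1/2) ^ m"
    proof (cases m)
      case (Suc k)
      then have "\<not> (1/2) ^ Suc k < t - s"
        using not_less_Least[of k "\<lambda>m. (1/2) ^ Suc m < t - s"] by (simp add: m_def)
      then show ?thesis by (simp add: Suc)
    qed (use st in simp)
    define i where "i = nat \<lfloor>2 ^ m * s\<rfloor>"
    define j where "j = nat \<lfloor>2 ^ m * t\<rfloor>"
    have "2 ^ m * t \<le> 2 ^ m * s + 1"
      using m2 by (simp add: field_simps)
    then have "\<lfloor>2 ^ m * t\<rfloor> = \<lfloor>2 ^ m * s\<rfloor> \<or> \<lfloor>2 ^ m * t\<rfloor> = \<lfloor>2 ^ m * s\<rfloor> + 1"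
      using floor_mono[of "2 ^ m * s" "2 ^ m * t"] floor_mono[of "2 ^ m * t" "2 ^ m * s + 1"] st
      by auto
    moreover have "\<lfloor>2 ^ m * s\<rfloor> \<ge> 0"
      using st by simp
    ultimately have ij: "j = i \<or> j = Suc i"
      unfolding i_def j_def by (auto simp: nat_add_distrib)
    have mid: "norm (g (real j / 2 ^ m) - g (real i / 2 ^ m)) \<le> K * q ^ m"
    proof (cases "j = i")
      case False
      then have j: "j = Suc i" using ij by simp
      have "real j \<le> 2 ^ m * t"
        using st by (simp add: j_def)
      also have "\<dots> \<le> 2 ^ m"
        using st by simp
      finally have "real j \<le> real (2 ^ m)" by simp
      then have "i < 2 ^ m"
        using j by linarith
      from incr[OF this] show ?thesis
        by (simp add: j q_def)
    qed (use q \<open>K \<ge> 0\<close> in simp)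
    have s': "norm (g s - g (real i / 2 ^ m)) \<le> K * q ^ m / (1 - q)"
      unfolding i_def by (rule dyadic_approximation_le[OF cont q \<open>K \<ge> 0\<close> incr[folded q_def] st(1)])
    have t': "norm (g t - g (real j / 2 ^ m)) \<le> K * q ^ m / (1 - q)"
      unfolding j_def by (rule dyadic_approximation_le[OF cont q \<open>K \<ge> 0\<close> incr[folded q_def] st(2)])
    have "norm (g t - g s) = norm ((g t - g (real j / 2 ^ m)) + (g (real j / 2 ^ m) - g (real i / 2 ^ m))
        - (g s - g (real i / 2 ^ m)))"
      by simp
    also have "\<dots> \<le> norm (g t - g (real j / 2 ^ m)) + norm (g (real j / 2 ^ m) - g (real i / 2 ^ m))
        + norm (g s - g (real i / 2 ^ m))"
      by (intro order_trans[OF norm_triangle_ineq4] add_right_mono norm_triangle_ineq)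
    also have "\<dots> \<le> K * q ^ m / (1 - q) + K * q ^ m + K * q ^ m / (1 - q)"
      by (intro add_mono s' t' mid)
    also have "\<dots> = K * (1 + 2 / (1 - q)) * q ^ m"
      by (simp add: algebra_simps)
    also have "\<dots> = L * q ^ Suc m"
      using q by (simp add: L_def)
    also have "\<dots> \<le> L * (t - s) powr \<gamma>"
    proof (intro mult_left_mono)
      have "q ^ Suc m = ((1/2) powr \<gamma>) ^ Suc m"
        by (simp add: q_def powr_minus powr_divide inverse_eq_divide)
      also have "\<dots> = ((1/2) ^ Suc m) powr \<gamma>"
        by (simp add: powr_power powr_powr powr_realpow[symmetric] mult.commute del: power_Suc)
      also have "\<dots> \<le> (t - s) powr \<gamma>"
        using m1 \<open>\<gamma> > 0\<close> by (intro powr_mono2) auto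
      finally show "q ^ Suc m \<le> (t - s) powr \<gamma>" .
      show "L \<ge> 0"
        using q \<open>K \<ge> 0\<close> by (simp add: L_def)
    qed
    finally show ?thesis .
  qed
  show ?thesis
  proof (intro exI[of _ L] ballI)
    fix s t :: real assume st: "s \<in> {0..1}" "t \<in> {0..1}"
    consider "s < t" | "t < s" | "s = t" by linarith
    then show "norm (g s - g t) \<le> L * \<bar>s - t\<bar> powr \<gamma>"
      using main[of s t] main[of t s] st by cases (auto simp: norm_minus_commute)
  qed
qed

context standard_brownian_motion
begin

lemma increment_measurable:
  assumes "0 \<le> s" "0 \<le> t"
  shows "random_variable borel (\<lambda>\<omega>. B t \<omega> - B s \<omega>)"
  using random_variable_BM[OF assms(1)] random_variable_BM[OF assms(2)] by simp

text \<open>The increment over the doubled time \<open>2 * h\<close> supplies the vector of variance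
  \<open>2 * h\<close> for the tail estimate.\<close>

lemma prob_increment_ge_le:
  assumes "0 \<le> s" "0 < h" "0 \<le> a"
  shows "prob {\<omega> \<in> space M. a \<le> norm (B (s + h) \<omega> - B s \<omega>)} \<le> sqrt 2 ^ CARD('d) * exp (- a\<^sup>2 / (4 * h))"
  using gaussian_increments[of s "s + h"] gaussian_increments[of s "s + 2 * h"] assms
  by (intro prob_gauss_tail_le[of _ _ "\<lambda>\<omega>. B (s + 2 * h) \<omega> - B s \<omega>"]) auto

text \<open>A union bound over the \<open>2 ^ k\<close> increments of level \<open>k\<close>, then
  Borel--Cantelli. Since \<open>\<gamma> < 1/2\<close>, each tail is doubly exponentially small in
  \<open>k\<close> and beats the number of increments.\<close>

lemma AE_eventually_dyadic_increments_less:
  assumes \<gamma>: "\<gamma> < 1/2"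
  shows "AE \<omega> in M. \<forall>\<^sub>F k in sequentially. \<forall>j<2 ^ k.
    norm (B (real (Suc j) / 2 ^ k) \<omega> - B (real j / 2 ^ k) \<omega>) < (2 powr - \<gamma>) ^ k"
proof -
  define q where "q = 2 powr - \<gamma>"
  define E where "E k j = {\<omega> \<in> space M. q ^ k \<le> norm (B (real j / 2 ^ k + 1 / 2 ^ k) \<omega> - B (real j / 2 ^ k) \<omega>)}"
    for k j :: nat
  define F where "F k = (\<Union>j<2 ^ k. E k j)" for k
  have [measurable]: "E k j \<in> events" for k j
  proof -
    have [measurable]: "random_variable borel (\<lambda>\<omega>. B (real j / 2 ^ k + 1 / 2 ^ k) \<omega> - B (real j / 2 ^ k) \<omega>)"
      by (rule increment_measurable) auto
    show ?thesis unfolding E_def by measurable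
  qed
  have F[measurable]: "F k \<in> events" for k
    unfolding F_def by measurable
  define c where "c = 1 - 2 * \<gamma>"
  have c: "c > 0" using \<gamma> by (simp add: c_def)
  have E_le: "prob (E k j) \<le> sqrt 2 ^ CARD('d) * exp (- (2 powr (c * k)) / 4)" for k j
  proof -
    have "(q ^ k)\<^sup>2 / (4 * (1 / 2 ^ k)) = 2 powr (c * k) / 4"
      by (simp add: q_def c_def powr_powr powr_realpow[symmetric] power2_eq_square powr_add[symmetric] algebra_simps)
    then have "- (q ^ k)\<^sup>2 / (4 * (1 / 2 ^ k)) = - (2 powr (c * k)) / 4"
      by (metis minus_divide_left)
    then show ?thesis
      using prob_increment_ge_le[of "real j / 2 ^ k" "1 / 2 ^ k" "q ^ k"]
      unfolding E_def by (simp add: q_def)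
  qed
  have F_le: "prob (F k) \<le> sqrt 2 ^ CARD('d) * (2 ^ k * exp (- (2 powr (c * k)) / 4))" for k
  proof -
    have "prob (F k) \<le> (\<Sum>j<2 ^ k. prob (E k j))"
      unfolding F_def by (rule finite_measure_subadditive_finite) auto
    also have "\<dots> \<le> (\<Sum>j<(2::nat) ^ k. sqrt 2 ^ CARD('d) * exp (- (2 powr (c * k)) / 4))"
      by (intro sum_mono E_le)
    finally show ?thesis by (simp add: mult_ac)
  qed
  have "summable (\<lambda>k. sqrt 2 ^ CARD('d) * (2 ^ k * exp (- (2 powr (c * real k)) / 4)))"
  proof (intro summable_mult)
    have "(\<lambda>k. 2 ^ k * exp (- (2 powr (c * real k)) / 4)) \<in> O(\<lambda>k. (1/2) ^ k)"
      using c by real_asymp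
    then show "summable (\<lambda>k. 2 ^ k * exp (- (2 powr (c * real k)) / 4))"
      by (rule summable_comparison_test_bigo[rotated]) simp
  qed
  then have "summable (\<lambda>k. prob (F k))"
    by (rule summable_comparison_test[rotated]) (use F_le in auto)
  then have "AE \<omega> in M. \<forall>\<^sub>F k in sequentially. \<omega> \<in> space M - F k"
    by (intro borel_cantelli_AE1 F) (auto simp: emeasure_eq_measure)
  then show ?thesis
  proof eventually_elim
    case (elim \<omega>)
    then show ?case
    proof eventually_elim
      case (elim k)
      have "real (Suc j) / 2 ^ k = real j / 2 ^ k + 1 / 2 ^ k" for j
        by (simp add: add_divide_distrib)
      then show ?case
        using elim by (auto simp: F_def E_def q_def not_le)
    qed
  qed
qed

lemma AE_Hoelder:
  assumes \<gamma>: "0 < \<gamma>" "\<gamma> < 1/2"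
  shows "AE \<omega> in M. \<exists>K. \<forall>s\<in>{0..1}. \<forall>t\<in>{0..1}. norm (B s \<omega> - B t \<omega>) \<le> K * \<bar>s - t\<bar> powr \<gamma>"
  using AE_eventually_dyadic_increments_less[OF \<gamma>(2)] continuous_paths
proof eventually_elim
  case (elim \<omega>)
  define q where "q = 2 powr - \<gamma>"
  have q: "q > 0" by (simp add: q_def)
  define I where "I k j = norm (B (real (Suc j) / 2 ^ k) \<omega> - B (real j / 2 ^ k) \<omega>)" for k j :: nat
  obtain N where N: "\<And>k j. k \<ge> N \<Longrightarrow> j < 2 ^ k \<Longrightarrow> I k j < q ^ k"
    using elim(1) unfolding eventually_sequentially I_def q_def by blast
  \<comment> \<open>The summand 1 serves the levels from \<open>N\<close> on; the finite sum
    dominates every ratio at the lower levels.\<close>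
  define K where "K = 1 + (\<Sum>k<N. \<Sum>j<2 ^ k. I k j / q ^ k)"
  have I: "I k j / q ^ k \<ge> 0" for k j
    using q by (simp add: I_def)
  then have K1: "K \<ge> 1"
    unfolding K_def by (simp add: sum_nonneg)
  have K: "I k j \<le> K * q ^ k" if "j < 2 ^ k" for k j
  proof (cases "k < N")
    case True
    have "I k j / q ^ k \<le> (\<Sum>j<2 ^ k. I k j / q ^ k)"
      using that I by (intro member_le_sum) auto
    also have "\<dots> \<le> (\<Sum>k<N. \<Sum>j<2 ^ k. I k j / q ^ k)"
      using True by (intro member_le_sum[of k "{..<N}" "\<lambda>k. \<Sum>j<2 ^ k. I k j / q ^ k"] sum_nonneg I) auto
    also have "\<dots> \<le> K" by (simp add: K_def)
    finally show ?thesis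
      using q by (simp add: field_simps)
  next
    case False
    then have "I k j \<le> 1 * q ^ k"
      using N[of k j] that by simp
    also have "\<dots> \<le> K * q ^ k"
      using K1 q by (intro mult_right_mono) auto
    finally show ?thesis .
  qed
  have "continuous_on {0..1} (\<lambda>t. B t \<omega>)"
    using elim(2) by (rule continuous_on_subset) auto
  then show ?case
    using K1 K unfolding I_def q_def by (intro dyadic_chaining[of _ _ K]) (use \<gamma> in auto)
qed

end

subsection \<open>Second moment method\<close>

text \<open>\<open>T n\<close> and \<open>g n\<close> do not depend on \<omega>, so expected pair
  counts are sums of the probabilities in \<open>close\<close>. \<open>E\<close> is quantified
  inside the almost sure statement and may therefore depend on \<omega>.\<close>

lemma (in prob_space) AE_eventually_card_le_packing_number:
  fixes Y :: "'i \<Rightarrow> 'a \<Rightarrow> 'b::euclidean_space" and g :: "nat \<Rightarrow> 'i \<Rightarrow> 'b" and \<eta> \<delta> L :: real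
  assumes Y: "\<And>n t. t \<in> T n \<Longrightarrow> random_variable borel (Y t)"
    and fin: "\<And>n. finite (T n)"
    and inj: "\<And>n. inj_on (g n) (T n)"
    and packing: "\<And>n. disjoint_family_on (\<lambda>x. ball x ((1/2) ^ n)) (g n ` T n)"
    and diam: "\<And>n s t. s \<in> T n \<Longrightarrow> t \<in> T n \<Longrightarrow> dist (g n s) (g n t) < 2 ^ m"
    and close: "\<And>n s t. s \<in> T n \<Longrightarrow> t \<in> T n \<Longrightarrow> s \<noteq> t \<Longrightarrow>
      prob {\<omega> \<in> space M. dist (Y s \<omega>) (Y t \<omega>) < 8 * (1/2) ^ n}
        \<le> L * 2 powr (\<eta> * n) * ((1/2) ^ n / dist (g n s) (g n t)) ^ DIM('b)"
    and "0 \<le> L" "0 \<le> \<eta>" "\<eta> < \<delta>"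
  shows "AE \<omega> in M. \<forall>\<^sub>F n in sequentially. \<forall>E. bounded E \<longrightarrow> (\<lambda>t. Y t \<omega>) ` T n \<subseteq> E \<longrightarrow>
    real (card (T n)) \<le> 2 powr (\<delta> * n) * packing_number E (2 * (1/2) ^ n)"
proof -
  define P where "P n s t = {\<omega> \<in> space M. dist (Y s \<omega>) (Y t \<omega>) < 8 * (1/2) ^ n}" for n s t
  have P[measurable]: "P n s t \<in> events" if "s \<in> T n" "t \<in> T n" for n s t
  proof -
    have [measurable]: "random_variable borel (Y s)" "random_variable borel (Y t)"
      using Y that by auto
    show ?thesis unfolding P_def by measurable
  qed
  define Z where "Z n \<omega> = (\<Sum>s\<in>T n. \<Sum>t\<in>T n. indicat_real (P n s t) \<omega>)" for n \<omega>
  have Z_int: "integrable M (Z n)" for n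
    unfolding Z_def by (intro Bochner_Integration.integrable_sum integrable_real_indicator P) (auto simp: emeasure_eq_measure)
  have Z_card: "Z n \<omega> = card {(s, t) \<in> T n \<times> T n. dist (Y s \<omega>) (Y t \<omega>) < 4 * (2 * (1/2) ^ n)}"
    if "\<omega> \<in> space M" for n \<omega>
  proof -
    have "Z n \<omega> = (\<Sum>(s, t)\<in>T n \<times> T n. if dist (Y s \<omega>) (Y t \<omega>) < 8 * (1/2) ^ n then 1 else 0)"
      unfolding Z_def using that by (subst sum.cartesian_product) (auto simp: P_def indicator_def intro!: sum.cong)
    also have "\<dots> = (\<Sum>p\<in>T n \<times> T n. if dist (Y (fst p) \<omega>) (Y (snd p) \<omega>) < 8 * (1/2) ^ n then 1 else 0)"
      by (intro sum.cong) auto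
    also have "\<dots> = card {p \<in> T n \<times> T n. dist (Y (fst p) \<omega>) (Y (snd p) \<omega>) < 8 * (1/2) ^ n}"
      using fin by (subst sum.inter_filter[symmetric]) auto
    also have "{p \<in> T n \<times> T n. dist (Y (fst p) \<omega>) (Y (snd p) \<omega>) < 8 * (1/2) ^ n}
        = {(s, t) \<in> T n \<times> T n. dist (Y s \<omega>) (Y t \<omega>) < 4 * (2 * (1/2) ^ n)}"
      by auto
    finally show ?thesis .
  qed
  \<comment> \<open>The 1 pays for the diagonal pair, \<open>L * 4 ^ DIM('b)\<close> for each
    annulus.\<close>
  define C where "C = 1 + L * 4 ^ DIM('b)"
  define W where "W n = 2 powr (\<eta> * real n)" for n :: nat
  have W: "W n \<ge> 1" for n
    using \<open>0 \<le> \<eta>\<close> by (simp add: W_def ge_one_powr_ge_zero)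
  have EZ: "expectation (Z n) \<le> card (T n) * (C * (1 + n + m) * W n)" for n
  proof -
    have row: "(\<Sum>t\<in>T n. prob (P n s t)) \<le> C * (1 + n + m) * W n" if s: "s \<in> T n" for s
    proof -
      have "(\<Sum>t\<in>T n. prob (P n s t)) = prob (P n s s) + (\<Sum>t\<in>T n - {s}. prob (P n s t))"
        using s fin by (simp add: sum.remove)
      also have "\<dots> \<le> 1 + (\<Sum>t\<in>T n - {s}. L * W n * ((1/2) ^ n / dist (g n s) (g n t)) ^ DIM('b))"
        unfolding P_def W_def using s by (intro add_mono sum_mono close) auto
      also have "(\<Sum>t\<in>T n - {s}. L * W n * ((1/2) ^ n / dist (g n s) (g n t)) ^ DIM('b))
          = L * W n * (\<Sum>y\<in>g n ` (T n - {s}). ((1/2) ^ n / dist (g n s) y) ^ DIM('b))"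
        using inj_on_subset[OF inj] by (subst sum.reindex) (auto simp: sum_distrib_left)
      also have "g n ` (T n - {s}) = g n ` T n - {g n s}"
        using s inj_on_image_set_diff[OF inj[of n], of "T n" "{s}"] by auto
      also have "1 + L * W n * (\<Sum>y\<in>g n ` T n - {g n s}. ((1/2) ^ n / dist (g n s) y) ^ DIM('b))
          \<le> 1 + L * W n * (4 ^ DIM('b) * real (n + m))"
      proof (intro add_left_mono mult_left_mono sum_packing_dist_powers_le packing)
        fix y assume "y \<in> g n ` T n"
        then have "dist (g n s) y < 2 ^ m"
          using diam s by auto
        \<comment> \<open>In units of the packing radius the diameter bound becomes
          \<open>2 ^ (n + m)\<close>, which gives \<open>n + m\<close> annuli.\<close>
        then show "dist (g n s) y < 2 ^ (n + m) * (1/2) ^ n"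
          by (simp add: power_add power_divide)
      qed (use s fin \<open>0 \<le> L\<close> W[of n] in auto)
      also have "\<dots> \<le> C * (1 + n + m) * W n"
      proof -
        have "1 * 1 \<le> (1 + real n + real m) * W n"
          using W[of n] by (intro mult_mono) auto
        moreover have "0 \<le> L * 4 ^ DIM('b) * W n"
          using W[of n] \<open>0 \<le> L\<close> by simp
        ultimately show ?thesis
          by (simp add: C_def algebra_simps)
      qed
      finally show ?thesis .
    qed
    have "expectation (Z n) = (\<Sum>s\<in>T n. \<Sum>t\<in>T n. prob (P n s t))"
    proof -
      have int: "integrable M (indicat_real (P n s t))" if "s \<in> T n" "t \<in> T n" for s t
        using that by (intro integrable_real_indicator P) (auto simp: emeasure_eq_measure)
      have "expectation (Z n) = (\<Sum>s\<in>T n. expectation (\<lambda>\<omega>. \<Sum>t\<in>T n. indicat_real (P n s t) \<omega>))"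
        unfolding Z_def
        by (rule Bochner_Integration.integral_sum) (intro Bochner_Integration.integrable_sum int)
      also have "\<dots> = (\<Sum>s\<in>T n. \<Sum>t\<in>T n. expectation (indicat_real (P n s t)))"
        by (intro sum.cong refl Bochner_Integration.integral_sum int)
      also have "\<dots> = (\<Sum>s\<in>T n. \<Sum>t\<in>T n. prob (P n s t))"
        by (intro sum.cong refl) (simp add: P)
      finally show ?thesis .
    qed
    also have "\<dots> \<le> (\<Sum>s\<in>T n. C * (1 + n + m) * W n)"
      by (intro sum_mono row)
    finally show ?thesis by simp
  qed
  \<comment> \<open>The gap between the exponents absorbs the factor linear in \<open>n\<close> and
    makes the Markov bounds summable.\<close>
  define c where "c = \<delta> - \<eta>"
  have c: "c > 0" using \<open>\<eta> < \<delta>\<close> by (simp add: c_def)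
  \<comment> \<open>The exceptional event of Markov's inequality. For empty \<open>T n\<close> both
    sides are 0 and the inequality always holds, so the event is made empty there.\<close>
  define G where "G n = {\<omega> \<in> space M. Z n \<omega> \<ge> card (T n) * 2 powr (\<delta> * n)} \<inter> (if T n = {} then {} else space M)" for n
  have [measurable]: "Z n \<in> borel_measurable M" for n
    using Z_int by (rule borel_measurable_integrable)
  have G[measurable]: "G n \<in> events" for n
    unfolding G_def by measurable
  have PG: "prob (G n) \<le> C * ((1 + n + m) * 2 powr (- c * n))" for n
  proof (cases "T n = {}")
    case True
    then show ?thesis using \<open>0 \<le> L\<close> by (simp add: G_def C_def)
  next
    case False
    then have N: "card (T n) > 0"
      using fin by (simp add: card_gt_0_iff)
    have "prob (G n) = prob {\<omega> \<in> space M. Z n \<omega> \<ge> card (T n) * 2 powr (\<delta> * n)}"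
      using False by (simp add: G_def Int_absorb2 Collect_conj_eq)
    also have "\<dots> \<le> expectation (Z n) / (card (T n) * 2 powr (\<delta> * n))"
      using N by (intro integral_Markov_inequality_measure[where A = "{}"] Z_int)
        (auto simp: Z_def intro!: sum_nonneg)
    also have "\<dots> \<le> (card (T n) * (C * (1 + n + m) * W n)) / (card (T n) * 2 powr (\<delta> * n))"
      by (intro divide_right_mono EZ) auto
    also have "\<dots> = C * (1 + n + m) * (W n / 2 powr (\<delta> * n))"
      using N by simp
    also have "W n / 2 powr (\<delta> * n) = 2 powr (- c * n)"
      by (simp add: W_def c_def powr_diff[symmetric] algebra_simps)
    finally show ?thesis by (simp add: mult_ac)
  qed
  have "summable (\<lambda>n. C * ((1 + real n + real m) * 2 powr (- c * real n)))"
  proof (intro summable_mult)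
    have "(\<lambda>n. (1 + real n + real m) * 2 powr (- c * real n)) \<in> O(\<lambda>n. (2 powr (- c / 2)) ^ n)"
      using c by real_asymp
    moreover have "summable (\<lambda>n. norm ((2 powr (- c / 2)) ^ n))"
      using c by (simp add: norm_power summable_geometric powr_less_one)
    ultimately show "summable (\<lambda>n. (1 + real n + real m) * 2 powr (- c * real n))"
      by (rule summable_comparison_test_bigo[rotated])
  qed
  then have "summable (\<lambda>n. prob (G n))"
    by (rule summable_comparison_test[rotated]) (use PG in \<open>auto simp: add.assoc\<close>)
  then have "AE \<omega> in M. \<forall>\<^sub>F n in sequentially. \<omega> \<in> space M - G n"
    by (intro borel_cantelli_AE1 G) (auto simp: emeasure_eq_measure)
  then show ?thesis
  proof eventually_elim
    case (elim \<omega>)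
    then show ?case
    proof eventually_elim
      case (elim n)
      show ?case
      proof (intro allI impI, cases "T n = {}")
        case False
        fix E assume E: "bounded E" "(\<lambda>t. Y t \<omega>) ` T n \<subseteq> E"
        have N: "card (T n) > 0"
          using fin False by (simp add: card_gt_0_iff)
        have "Z n \<omega> < card (T n) * 2 powr (\<delta> * n)"
          using elim False by (auto simp: G_def not_le)
        \<comment> \<open>Taken at radius \<open>r = 2 * (1/2) ^ n\<close>, so that
          \<open>4 * r\<close> is the threshold \<open>8 * (1/2) ^ n\<close> in
          \<open>close\<close>.\<close>
        have "(card (T n))\<^sup>2 \<le> card {(s, t) \<in> T n \<times> T n. dist (Y s \<omega>) (Y t \<omega>) < 4 * (2 * (1/2) ^ n)}
            * packing_number E (2 * (1/2) ^ n)"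
          by (rule card_squared_le_close_pairs[OF fin E(2,1)]) simp
        then have "(real (card (T n)))\<^sup>2 \<le> Z n \<omega> * packing_number E (2 * (1/2) ^ n)"
          using elim Z_card[of \<omega> n] by (simp flip: of_nat_mult of_nat_power)
        also have "\<dots> \<le> (card (T n) * 2 powr (\<delta> * n)) * packing_number E (2 * (1/2) ^ n)"
          using \<open>Z n \<omega> < _\<close> by (intro mult_right_mono) auto
        finally show "real (card (T n)) \<le> 2 powr (\<delta> * n) * packing_number E (2 * (1/2) ^ n)"
          using N by (simp add: power2_eq_square mult.assoc)
      qed simp
    qed
  qed
qed

subsection \<open>Brownian motion with drift\<close>

text \<open>One preimage per center turns an optimal packing in space into a set of times.\<close>

lemma packing_preimage:
  fixes f :: "'i \<Rightarrow> 'a::euclidean_space"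
  assumes "bounded (f ` A)" "\<epsilon> > 0"
  obtains T where "T \<subseteq> A" "finite T" "inj_on f T" "disjoint_family_on (\<lambda>x. ball x \<epsilon>) (f ` T)"
    "card T = packing_number (f ` A) \<epsilon>"
proof -
  obtain C where C: "C \<subseteq> f ` A" "finite C" "disjoint_family_on (\<lambda>x. ball x \<epsilon>) C"
    "card C = packing_number (f ` A) \<epsilon>"
    using packing_number_attained[OF assms] by blast
  obtain T where T: "T \<subseteq> A" "inj_on f T" "C = f ` T"
    using C(1) by (auto simp: subset_image_inj)
  show ?thesis
    using C T by (intro that[of T]) (auto simp: card_image finite_image_iff)
qed

lemma less_two_power: "\<exists>m. x < (2::real) ^ m"
  using real_arch_pow[of 2 x] by simp

text \<open>Inverts the Hoelder bound: \<open>w powr (1 / (2 * \<gamma>))\<close> is at most a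
  constant times \<open>sqrt h\<close>. The exponent exceeds 1 by
  \<open>1 / (2 * \<gamma>) - 1\<close>, and that excess power of \<open>w\<close> is bounded below
  by the same power of \<epsilon>.\<close>

lemma Hoelder_radius_ratio_le:
  assumes "0 < \<gamma>" "\<gamma> < 1/2" "K \<ge> 1" "0 < \<epsilon>" "\<epsilon> \<le> w" "h > 0" "w \<le> K * h powr \<gamma>"
  shows "\<epsilon> / sqrt h \<le> K powr (1 / (2 * \<gamma>)) * \<epsilon> powr - (1 / (2 * \<gamma>) - 1) * (\<epsilon> / w)"
proof -
  define \<eta> where "\<eta> = 1 / (2 * \<gamma>) - 1"
  have \<eta>: "\<eta> > 0" "1 / (2 * \<gamma>) = 1 + \<eta>"
    using assms by (simp_all add: \<eta>_def field_simps)
  have "w * \<epsilon> powr \<eta> \<le> w * w powr \<eta>"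
    using assms \<eta> by (intro mult_left_mono powr_mono2) auto
  also have "\<dots> = w powr (1 / (2 * \<gamma>))"
    using assms by (simp add: \<eta>(2) powr_add)
  also have "\<dots> \<le> (K * h powr \<gamma>) powr (1 / (2 * \<gamma>))"
    using assms by (intro powr_mono2) auto
  also have "\<dots> = K powr (1 / (2 * \<gamma>)) * sqrt h"
    using assms by (simp add: powr_mult powr_powr powr_half_sqrt)
  finally have "w * \<epsilon> powr \<eta> \<le> K powr (1 / (2 * \<gamma>)) * sqrt h" .
  then have "\<epsilon> * (w * \<epsilon> powr \<eta>) \<le> \<epsilon> * (K powr (1 / (2 * \<gamma>)) * sqrt h)"
    using assms by (intro mult_left_mono) auto
  then show ?thesis
    unfolding \<eta>_def[symmetric] using assms by (simp add: powr_minus field_simps)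
qed

context standard_brownian_motion
begin

text \<open>The drift moves into the center of the ball, which leaves a Gaussian increment.\<close>

lemma prob_close_eq:
  assumes "s < t"
  shows "{\<omega> \<in> space M. dist (B s \<omega> + f s) (B t \<omega> + f t) < r}
    = {\<omega> \<in> space M. dist (B t \<omega> - B s \<omega>) (f s - f t) < r}"
proof -
  have "B s \<omega> + f s - (B t \<omega> + f t) = - (B t \<omega> - B s \<omega> - (f s - f t))" for \<omega>
    by (simp add: algebra_simps)
  then show ?thesis
    by (simp only: dist_norm norm_minus_cancel)
qed

text \<open>The estimate uniform in the variance removes the time gap, so only the distance of the
  drift values remains.\<close>

lemma prob_close_le_dist:
  assumes "0 \<le> s" "0 \<le> t" "s \<noteq> t" "f s \<noteq> f t" "r > 0"
  shows "prob {\<omega> \<in> space M. dist (B s \<omega> + f s) (B t \<omega> + f t) < r}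
    \<le> (2 ^ CARD('d) + unit_ball_vol (real CARD('d)) * (1 + (8 * real CARD('d)) ^ CARD('d)))
        * (r / dist (f s) (f t)) ^ CARD('d)"
  using assms
proof (induction s t rule: linorder_wlog)
  case (le s t)
  then have "s < t" by simp
  have "prob {\<omega> \<in> space M. dist (B t \<omega> - B s \<omega>) (f s - f t) < r}
    \<le> (2 ^ CARD('d) + unit_ball_vol (real CARD('d)) * (1 + (8 * real CARD('d)) ^ CARD('d)))
        * (r / norm (f s - f t)) ^ CARD('d)"
    using le \<open>s < t\<close> by (intro prob_gauss_ball_le[OF gaussian_increments]) auto
  then show ?case
    unfolding prob_close_eq[OF \<open>s < t\<close>] dist_norm[of "f s"] .
next
  case (sym s t)
  then show ?case by (simp add: dist_commute)
qed

text \<open>Complementary to the previous bound: only the time gap remains, whatever the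
  drift.\<close>

lemma prob_close_le_sqrt:
  assumes "0 \<le> s" "0 \<le> t" "s \<noteq> t" "r > 0"
  shows "prob {\<omega> \<in> space M. dist (B s \<omega> + f s) (B t \<omega> + f t) < r}
    \<le> unit_ball_vol (real CARD('d)) * (r / sqrt \<bar>s - t\<bar>) ^ CARD('d)"
  using assms
proof (induction s t rule: linorder_wlog)
  case (le s t)
  then have "s < t" by simp
  have "prob {\<omega> \<in> space M. dist (B t \<omega> - B s \<omega>) (f s - f t) < r}
    \<le> unit_ball_vol (real CARD('d)) * (r / sqrt (t - s)) ^ CARD('d)"
    using le \<open>s < t\<close> by (intro prob_gauss_ball_le_sqrt[OF gaussian_increments]) auto
  moreover have "\<bar>s - t\<bar> = t - s"
    using \<open>s < t\<close> by simp
  ultimately show ?case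
    unfolding prob_close_eq[OF \<open>s < t\<close>] by simp
next
  case (sym s t)
  then show ?case by (simp add: dist_commute abs_minus_commute)
qed

text \<open>The second moment method with \<open>g\<close> equal to the drift, whose packing times
  are deterministic; there is no exponential loss, so \<eta> is 0.\<close>

lemma AE_packing_drift_le:
  fixes A :: "real set" and f :: "real \<Rightarrow> real ^ 'd" and \<delta> :: real
  assumes A: "A \<subseteq> {0..1}" and f: "bounded (f ` A)" and "\<delta> > 0"
  shows "AE \<omega> in M. \<forall>\<^sub>F n in sequentially. \<forall>E. bounded E \<longrightarrow> (\<lambda>t. B t \<omega> + f t) ` A \<subseteq> E \<longrightarrow>
    real (packing_number (f ` A) ((1/2) ^ n)) \<le> 2 powr (\<delta> * n) * packing_number E (2 * (1/2) ^ n)"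
proof -
  have "\<exists>T. T \<subseteq> A \<and> finite T \<and> inj_on f T \<and> disjoint_family_on (\<lambda>x. ball x ((1/2) ^ n)) (f ` T) \<and>
    card T = packing_number (f ` A) ((1/2) ^ n)" for n
    by (rule packing_preimage[OF f, of "(1/2) ^ n"]) auto
  then obtain T where T: "\<And>n. T n \<subseteq> A" "\<And>n. finite (T n)" "\<And>n. inj_on f (T n)"
    "\<And>n. disjoint_family_on (\<lambda>x. ball x ((1/2) ^ n)) (f ` T n)"
    "\<And>n. card (T n) = packing_number (f ` A) ((1/2) ^ n)"
    by metis
  obtain e where e: "\<And>s t. s \<in> A \<Longrightarrow> t \<in> A \<Longrightarrow> dist (f s) (f t) \<le> e"
    using f by (auto simp: bounded_two_points)
  obtain m where m: "e < 2 ^ m"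
    using less_two_power by blast
  define V where "V = 2 ^ CARD('d) + unit_ball_vol (real CARD('d)) * (1 + (8 * real CARD('d)) ^ CARD('d))"
  \<comment> \<open>The power of 8 comes from the closeness threshold
    \<open>8 * (1/2) ^ n\<close>.\<close>
  have V: "V * 8 ^ CARD('d) \<ge> 0"
    by (simp add: V_def)
  have "AE \<omega> in M. \<forall>\<^sub>F n in sequentially. \<forall>E. bounded E \<longrightarrow> (\<lambda>t. B t \<omega> + f t) ` T n \<subseteq> E \<longrightarrow>
    real (card (T n)) \<le> 2 powr (\<delta> * n) * packing_number E (2 * (1/2) ^ n)"
  proof (rule AE_eventually_card_le_packing_number[where g = "\<lambda>_. f" and m = m,
        OF _ T(2-4) _ _ V order.refl \<open>\<delta> > 0\<close>])
    fix n t assume "t \<in> T n"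
    then have "0 \<le> t" using T(1)[of n] A by auto
    then show "random_variable borel (\<lambda>\<omega>. B t \<omega> + f t)"
      using random_variable_BM by (intro borel_measurable_add) auto
  next
    fix n s t assume st: "s \<in> T n" "t \<in> T n"
    then have stA: "s \<in> A" "t \<in> A" "0 \<le> s" "0 \<le> t"
      using T(1)[of n] A by auto
    show "dist (f s) (f t) < 2 ^ m"
      using e[OF stA(1,2)] m by linarith
    assume "s \<noteq> t"
    then have "f s \<noteq> f t"
      using T(3)[of n] st by (auto simp: inj_on_def)
    show "prob {\<omega> \<in> space M. dist (B s \<omega> + f s) (B t \<omega> + f t) < 8 * (1/2) ^ n}
        \<le> V * 8 ^ CARD('d) * 2 powr (0 * real n) * ((1/2) ^ n / dist (f s) (f t)) ^ DIM(real ^ 'd)"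
      using prob_close_le_dist[of s t f "8 * (1/2) ^ n"] stA \<open>s \<noteq> t\<close> \<open>f s \<noteq> f t\<close>
      by (simp add: V_def power_mult_distrib power_divide mult.assoc)
  qed
  then show ?thesis
  proof eventually_elim
    case (elim \<omega>)
    then show ?case
    proof eventually_elim
      case (elim n)
      show ?case
      proof (intro allI impI)
        fix E assume E: "bounded E" "(\<lambda>t. B t \<omega> + f t) ` A \<subseteq> E"
        then have "(\<lambda>t. B t \<omega> + f t) ` T n \<subseteq> E"
          using T(1)[of n] by blast
        then show "real (packing_number (f ` A) ((1/2) ^ n)) \<le> 2 powr (\<delta> * n) * packing_number E (2 * (1/2) ^ n)"
          using elim E(1) unfolding T(5) by simp
      qed
    qed
  qed
qed

text \<open>The times of a packing of \<open>B ` A\<close> are random.  They are replaced by the times of a packing along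
  a fixed path which is best possible among the paths with the same Hoelder constant.\<close>
lemma AE_packing_Hoelder_path_le:
  fixes A :: "real set" and f :: "real \<Rightarrow> real ^ 'd" and \<gamma> \<delta> K :: real
  defines "H \<equiv> {\<omega>. \<forall>s\<in>{0..1}. \<forall>t\<in>{0..1}. norm (B s \<omega> - B t \<omega>) \<le> K * \<bar>s - t\<bar> powr \<gamma>}"
  assumes A: "A \<subseteq> {0..1}" "A \<noteq> {}" and \<gamma>: "0 < \<gamma>" "\<gamma> < 1/2" and "K \<ge> 1"
    and \<delta>: "(1 / (2 * \<gamma>) - 1) * CARD('d) < \<delta>"
  shows "AE \<omega> in M. \<omega> \<in> H \<longrightarrow> (\<forall>\<^sub>F n in sequentially. \<forall>E. bounded E \<longrightarrow>
    (\<lambda>t. B t \<omega> + f t) ` A \<subseteq> E \<longrightarrow>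
    real (packing_number ((\<lambda>t. B t \<omega>) ` A) ((1/2) ^ n)) \<le> 2 powr (\<delta> * n) * packing_number E (2 * (1/2) ^ n))"
proof (cases "H = {}")
  case False
  obtain a where a: "a \<in> A" using A by blast
  have dist_le: "dist (B s \<omega>) (B t \<omega>) \<le> K" if "\<omega> \<in> H" "s \<in> A" "t \<in> A" for \<omega> s t
  proof -
    have "dist (B s \<omega>) (B t \<omega>) \<le> K * \<bar>s - t\<bar> powr \<gamma>"
      using that A by (auto simp: H_def dist_norm)
    also have "\<dots> \<le> K * 1 powr \<gamma>"
    proof (intro mult_left_mono powr_mono2)
      have "s \<in> {0..1}" "t \<in> {0..1}" using that A by auto
      then show "\<bar>s - t\<bar> \<le> 1" by auto
    qed (use \<gamma> \<open>K \<ge> 1\<close> in auto)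
    finally show ?thesis by simp
  qed
  have sub: "(\<lambda>t. B t \<omega>) ` A \<subseteq> cball (B a \<omega>) K" if "\<omega> \<in> H" for \<omega>
    using dist_le[OF that a] by auto
  have bdd: "bounded ((\<lambda>t. B t \<omega>) ` A)" if "\<omega> \<in> H" for \<omega>
    by (rule bounded_subset[OF bounded_cball sub[OF that]])
  \<comment> \<open>Every path in \<open>H\<close> maps \<open>A\<close> into a ball of the same
    radius \<open>K\<close>, so the packing numbers at scale \<open>n\<close> are uniformly bounded
    and, being integers, attain their maximum.\<close>
  have "\<exists>\<omega>. \<omega> \<in> H \<and> (\<forall>\<omega>'. \<omega>' \<in> H \<longrightarrow>
    packing_number ((\<lambda>t. B t \<omega>') ` A) ((1/2) ^ n) \<le> packing_number ((\<lambda>t. B t \<omega>) ` A) ((1/2) ^ n))" for n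
  proof -
    obtain \<omega>0 where "\<omega>0 \<in> H" using False by blast
    then show ?thesis
    proof (rule ex_has_greatest_nat)
      show "\<forall>\<omega>. \<omega> \<in> H \<longrightarrow> packing_number ((\<lambda>t. B t \<omega>) ` A) ((1/2) ^ n)
          < Suc (nat \<lfloor>((K + (1/2) ^ n) / (1/2) ^ n) ^ DIM(real ^ 'd)\<rfloor>)"
      proof (intro allI impI le_imp_less_Suc le_nat_floor)
        fix \<omega> assume "\<omega> \<in> H"
        obtain C where C: "C \<subseteq> (\<lambda>t. B t \<omega>) ` A" "finite C" "disjoint_family_on (\<lambda>x. ball x ((1/2) ^ n)) C"
          "card C = packing_number ((\<lambda>t. B t \<omega>) ` A) ((1/2) ^ n)"
          using packing_number_attained[OF bdd[OF \<open>\<omega> \<in> H\<close>], of "(1/2) ^ n"] by auto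
        show "real (packing_number ((\<lambda>t. B t \<omega>) ` A) ((1/2) ^ n)) \<le> ((K + (1/2) ^ n) / (1/2) ^ n) ^ DIM(real ^ 'd)"
          using card_packing_le[OF C(2,3) order_trans[OF C(1) sub[OF \<open>\<omega> \<in> H\<close>]]] C(4) \<open>K \<ge> 1\<close> by simp
      qed
    qed
  qed
  then obtain \<xi> where \<xi>: "\<And>n. \<xi> n \<in> H" and \<xi>_max: "\<And>n \<omega>. \<omega> \<in> H \<Longrightarrow>
    packing_number ((\<lambda>t. B t \<omega>) ` A) ((1/2) ^ n) \<le> packing_number ((\<lambda>t. B t (\<xi> n)) ` A) ((1/2) ^ n)"
    by metis
  define g where "g n t = B t (\<xi> n)" for n t
  have "\<exists>T. T \<subseteq> A \<and> finite T \<and> inj_on (g n) T \<and> disjoint_family_on (\<lambda>x. ball x ((1/2) ^ n)) (g n ` T) \<and>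
    card T = packing_number (g n ` A) ((1/2) ^ n)" for n
    using bdd[OF \<xi>[of n]] packing_preimage[of "g n" A "(1/2) ^ n"] unfolding g_def by auto
  then obtain T where T: "\<And>n. T n \<subseteq> A" "\<And>n. finite (T n)" "\<And>n. inj_on (g n) (T n)"
    "\<And>n. disjoint_family_on (\<lambda>x. ball x ((1/2) ^ n)) (g n ` T n)"
    "\<And>n. card (T n) = packing_number (g n ` A) ((1/2) ^ n)"
    by metis
  obtain m where m: "K < 2 ^ m"
    using less_two_power by blast
  define V where "V = unit_ball_vol (real CARD('d))"
  \<comment> \<open>The exponent lost in \<open>Hoelder_radius_ratio_le\<close>; raising to the
    power d multiplies it by the dimension.\<close>
  define \<eta> where "\<eta> = 1 / (2 * \<gamma>) - 1"
  have \<eta>: "\<eta> \<ge> 0"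
    using \<gamma> by (simp add: \<eta>_def field_simps)
  define K' where "K' = K powr (1 / (2 * \<gamma>))"
  have V: "V * (8 * K') ^ CARD('d) \<ge> 0"
    by (simp add: V_def K'_def)
  have \<eta>': "0 \<le> \<eta> * CARD('d)" "\<eta> * CARD('d) < \<delta>"
    using \<eta> \<delta> by (simp_all add: \<eta>_def)
  have "AE \<omega> in M. \<forall>\<^sub>F n in sequentially. \<forall>E. bounded E \<longrightarrow> (\<lambda>t. B t \<omega> + f t) ` T n \<subseteq> E \<longrightarrow>
    real (card (T n)) \<le> 2 powr (\<delta> * n) * packing_number E (2 * (1/2) ^ n)"
  proof (rule AE_eventually_card_le_packing_number[where g = g and m = m, OF _ T(2-4) _ _ V \<eta>'])
    fix n t assume "t \<in> T n"
    then have "0 \<le> t" using T(1)[of n] A by auto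
    then show "random_variable borel (\<lambda>\<omega>. B t \<omega> + f t)"
      using random_variable_BM by (intro borel_measurable_add) auto
  next
    fix n s t assume st: "s \<in> T n" "t \<in> T n"
    then have stA: "s \<in> A" "t \<in> A"
      using T(1)[of n] by auto
    then have st01: "s \<in> {0..1}" "t \<in> {0..1}"
      using A by auto
    show "dist (g n s) (g n t) < 2 ^ m"
      using dist_le[OF \<xi> stA] m unfolding g_def by (rule order_le_less_trans)
    assume "s \<noteq> t"
    \<comment> \<open>Separation in the packing provides the hypothesis
      \<open>\<epsilon> \<le> w\<close> of \<open>Hoelder_radius_ratio_le\<close>.\<close>
    have ge: "(1/2) ^ n \<le> dist (g n s) (g n t)"
      using disjoint_balls_dist[OF T(4)[of n], of "g n s" "g n t"] T(3)[of n] st \<open>s \<noteq> t\<close>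
      by (auto simp: inj_on_def)
    have "dist (g n s) (g n t) \<le> K * \<bar>s - t\<bar> powr \<gamma>"
      using \<xi>[of n] st01 unfolding H_def g_def dist_norm by auto
    then have "(1/2) ^ n / sqrt \<bar>s - t\<bar> \<le> K' * ((1/2) ^ n) powr - \<eta> * ((1/2) ^ n / dist (g n s) (g n t))"
      unfolding K'_def \<eta>_def using \<gamma> \<open>K \<ge> 1\<close> ge \<open>s \<noteq> t\<close>
      by (intro Hoelder_radius_ratio_le) auto
    also have "((1/2) ^ n) powr - \<eta> = 2 powr (\<eta> * n)"
      by (simp add: power_divide powr_divide powr_minus powr_realpow[symmetric] powr_powr inverse_eq_divide mult.commute)
    finally have le: "8 * (1/2) ^ n / sqrt \<bar>s - t\<bar>
        \<le> (8 * K') * (2 powr (\<eta> * n) * ((1/2) ^ n / dist (g n s) (g n t)))"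
      by simp
    have "prob {\<omega> \<in> space M. dist (B s \<omega> + f s) (B t \<omega> + f t) < 8 * (1/2) ^ n}
        \<le> V * (8 * (1/2) ^ n / sqrt \<bar>s - t\<bar>) ^ CARD('d)"
      unfolding V_def using st01 \<open>s \<noteq> t\<close> by (intro prob_close_le_sqrt) auto
    also have "\<dots> \<le> V * ((8 * K') * (2 powr (\<eta> * n) * ((1/2) ^ n / dist (g n s) (g n t)))) ^ CARD('d)"
      using le by (intro mult_left_mono power_mono) (auto simp: V_def)
    also have "\<dots> = V * (8 * K') ^ CARD('d) * (2 powr (\<eta> * n)) ^ CARD('d)
        * ((1/2) ^ n / dist (g n s) (g n t)) ^ CARD('d)"
      by (simp only: power_mult_distrib mult.assoc)
    also have "(2 powr (\<eta> * n)) ^ CARD('d) = 2 powr (\<eta> * CARD('d) * n)"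
      by (simp add: powr_power mult_ac)
    finally show "prob {\<omega> \<in> space M. dist (B s \<omega> + f s) (B t \<omega> + f t) < 8 * (1/2) ^ n}
        \<le> V * (8 * K') ^ CARD('d) * 2 powr (\<eta> * CARD('d) * n) * ((1/2) ^ n / dist (g n s) (g n t)) ^ DIM(real ^ 'd)"
      by simp
  qed
  then show ?thesis
  proof eventually_elim
    case (elim \<omega>)
    show ?case
    proof
      assume "\<omega> \<in> H"
      show "\<forall>\<^sub>F n in sequentially. \<forall>E. bounded E \<longrightarrow> (\<lambda>t. B t \<omega> + f t) ` A \<subseteq> E \<longrightarrow>
        real (packing_number ((\<lambda>t. B t \<omega>) ` A) ((1/2) ^ n)) \<le> 2 powr (\<delta> * n) * packing_number E (2 * (1/2) ^ n)"
        using elim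
      proof eventually_elim
        case (elim n)
        \<comment> \<open>By maximality of \<open>\<xi> n\<close>, the deterministic set of times is
          at least as large as any packing along \<omega>.\<close>
        have "packing_number ((\<lambda>t. B t \<omega>) ` A) ((1/2) ^ n) \<le> card (T n)"
          using \<xi>_max[OF \<open>\<omega> \<in> H\<close>, of n] T(5)[of n] by (simp add: g_def)
        then have le: "real (packing_number ((\<lambda>t. B t \<omega>) ` A) ((1/2) ^ n)) \<le> real (card (T n))"
          by simp
        show ?case
        proof (intro allI impI)
          fix E assume E: "bounded E" "(\<lambda>t. B t \<omega> + f t) ` A \<subseteq> E"
          then have "(\<lambda>t. B t \<omega> + f t) ` T n \<subseteq> E"
            using T(1)[of n] by blast
          with elim E(1) have "real (card (T n)) \<le> 2 powr (\<delta> * n) * packing_number E (2 * (1/2) ^ n)"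
            by simp
          with le show "real (packing_number ((\<lambda>t. B t \<omega>) ` A) ((1/2) ^ n))
              \<le> 2 powr (\<delta> * n) * packing_number E (2 * (1/2) ^ n)"
            by (rule order_trans)
        qed
      qed
    qed
  qed
qed simp

text \<open>Almost every path is Hoelder, and its constant may be rounded up to a positive integer,
  so countably many exceptional null sets suffice.\<close>

lemma AE_packing_path_le:
  fixes A :: "real set" and f :: "real \<Rightarrow> real ^ 'd" and \<delta> :: real
  assumes A: "A \<subseteq> {0..1}" "A \<noteq> {}" and "\<delta> > 0"
  shows "AE \<omega> in M. \<forall>\<^sub>F n in sequentially. \<forall>E. bounded E \<longrightarrow> (\<lambda>t. B t \<omega> + f t) ` A \<subseteq> E \<longrightarrow>
    real (packing_number ((\<lambda>t. B t \<omega>) ` A) ((1/2) ^ n)) \<le> 2 powr (\<delta> * n) * packing_number E (2 * (1/2) ^ n)"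
proof -
  define \<eta> where "\<eta> = \<delta> / (2 * CARD('d))"
  have \<eta>: "\<eta> > 0" "\<eta> * CARD('d) < \<delta>"
    using \<open>\<delta> > 0\<close> by (simp_all add: \<eta>_def)
  \<comment> \<open>Solves \<open>1 / (2 * \<gamma>) - 1 = \<eta>\<close>, so that the total
    exponential loss \<open>\<eta> * CARD('d)\<close> is half of \<delta>.\<close>
  define \<gamma> where "\<gamma> = 1 / (2 * (1 + \<eta>))"
  have \<gamma>: "0 < \<gamma>" "\<gamma> < 1/2" "1 / (2 * \<gamma>) - 1 = \<eta>"
    using \<eta>(1) by (simp_all add: \<gamma>_def field_simps)
  have "AE \<omega> in M. \<forall>K::nat. \<omega> \<in> {\<omega>. \<forall>s\<in>{0..1}. \<forall>t\<in>{0..1}.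
        norm (B s \<omega> - B t \<omega>) \<le> real (Suc K) * \<bar>s - t\<bar> powr \<gamma>} \<longrightarrow>
      (\<forall>\<^sub>F n in sequentially. \<forall>E. bounded E \<longrightarrow> (\<lambda>t. B t \<omega> + f t) ` A \<subseteq> E \<longrightarrow>
        real (packing_number ((\<lambda>t. B t \<omega>) ` A) ((1/2) ^ n)) \<le> 2 powr (\<delta> * n) * packing_number E (2 * (1/2) ^ n))"
    unfolding AE_all_countable
    using \<gamma> \<eta> by (intro allI AE_packing_Hoelder_path_le[OF A]) auto
  with AE_Hoelder[OF \<gamma>(1,2)] show ?thesis
  proof eventually_elim
    case (elim \<omega>)
    then obtain K where K: "\<And>s t. s \<in> {0..1} \<Longrightarrow> t \<in> {0..1} \<Longrightarrow> norm (B s \<omega> - B t \<omega>) \<le> K * \<bar>s - t\<bar> powr \<gamma>"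
      by blast
    obtain k :: nat where "K < real k"
      using reals_Archimedean2 by blast
    then have "K * \<bar>s - t\<bar> powr \<gamma> \<le> real (Suc k) * \<bar>s - t\<bar> powr \<gamma>" for s t
      by (intro mult_right_mono) auto
    then have "\<omega> \<in> {\<omega>. \<forall>s\<in>{0..1}. \<forall>t\<in>{0..1}. norm (B s \<omega> - B t \<omega>) \<le> real (Suc k) * \<bar>s - t\<bar> powr \<gamma>}"
      using order_trans[OF K] by simp
    then show ?case
      by (rule elim(2)[rule_format, of k])
  qed
qed

end

theorem theorem1p4:
  fixes M :: "'w measure"
    and B :: "real \<Rightarrow> 'w \<Rightarrow> real ^ 'd"
    and f :: "real \<Rightarrow> real ^ 'd"
    and A :: "real set"
  assumes "standard_brownian_motion M B"
    and "A \<noteq> {}" and "A \<subseteq> {0..1}"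
    and "cadlag_on 0 1 f"
  shows "AE \<omega> in M.
      upper_minkowski_dim ((\<lambda>t. B t \<omega> + f t) ` A)
        \<ge> max (upper_minkowski_dim ((\<lambda>t. B t \<omega>) ` A)) (upper_minkowski_dim (f ` A)) \<and>
      lower_minkowski_dim ((\<lambda>t. B t \<omega> + f t) ` A)
        \<ge> max (lower_minkowski_dim ((\<lambda>t. B t \<omega>) ` A)) (lower_minkowski_dim (f ` A))"
proof -
  interpret standard_brownian_motion M B by fact
  have f: "bounded (f ` A)"
    by (rule bounded_subset[OF cadlag_on_bounded[OF assms(4)]]) (use assms(3) in auto)
  \<comment> \<open>The exponents \<open>1 / Suc j\<close> replace all positive \<delta>, which
    keeps the exceptional set a countable union of null sets.\<close>
  have "AE \<omega> in M. \<forall>j::nat. \<forall>\<^sub>F n in sequentially. \<forall>E. bounded E \<longrightarrow> (\<lambda>t. B t \<omega> + f t) ` A \<subseteq> E \<longrightarrow>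
    real (packing_number (f ` A) ((1/2) ^ n)) \<le> 2 powr (1 / Suc j * n) * packing_number E (2 * (1/2) ^ n)"
    unfolding AE_all_countable by (intro allI AE_packing_drift_le assms f) simp
  moreover have "AE \<omega> in M. \<forall>j::nat. \<forall>\<^sub>F n in sequentially. \<forall>E. bounded E \<longrightarrow> (\<lambda>t. B t \<omega> + f t) ` A \<subseteq> E \<longrightarrow>
    real (packing_number ((\<lambda>t. B t \<omega>) ` A) ((1/2) ^ n)) \<le> 2 powr (1 / Suc j * n) * packing_number E (2 * (1/2) ^ n)"
    unfolding AE_all_countable by (intro allI AE_packing_path_le assms) simp
  ultimately show ?thesis
    using continuous_paths
  proof eventually_elim
    case (elim \<omega>)
    have "bounded ((\<lambda>t. B t \<omega>) ` {0..1})"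
      by (intro compact_imp_bounded compact_continuous_image continuous_on_subset[OF elim(3)]) auto
    then have B: "bounded ((\<lambda>t. B t \<omega>) ` A)"
      by (rule bounded_subset[OF _ image_mono[OF assms(3)]])
    have Y: "bounded ((\<lambda>t. B t \<omega> + f t) ` A)"
      by (rule bounded_plus_comp[OF B f])
    \<comment> \<open>Some \<open>1 / Suc j\<close> lies below \<delta>, and \<open>E'\<close> is
      taken to be the image of \<open>A\<close> under the path with drift.\<close>
    have *: "\<forall>\<^sub>F n in sequentially. real (packing_number E ((1/2) ^ n))
        \<le> 2 powr (\<delta> * n) * packing_number ((\<lambda>t. B t \<omega> + f t) ` A) (2 * (1/2) ^ n)"
      if "\<delta> > 0" and "\<forall>j::nat. \<forall>\<^sub>F n in sequentially. \<forall>E'. bounded E' \<longrightarrow> (\<lambda>t. B t \<omega> + f t) ` A \<subseteq> E' \<longrightarrow>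
        real (packing_number E ((1/2) ^ n)) \<le> 2 powr (1 / Suc j * n) * packing_number E' (2 * (1/2) ^ n)"
      for \<delta> :: real and E :: "(real ^ 'd) set"
    proof -
      obtain j where j: "1 / real (Suc j) < \<delta>"
        using reals_Archimedean[OF \<open>\<delta> > 0\<close>] by (auto simp: inverse_eq_divide)
      from that(2)[rule_format, of j] show ?thesis
      proof eventually_elim
        case (elim n)
        then have "real (packing_number E ((1/2) ^ n))
            \<le> 2 powr (1 / Suc j * n) * packing_number ((\<lambda>t. B t \<omega> + f t) ` A) (2 * (1/2) ^ n)"
          using Y by blast
        also have "\<dots> \<le> 2 powr (\<delta> * n) * packing_number ((\<lambda>t. B t \<omega> + f t) ` A) (2 * (1/2) ^ n)"
          using j by (intro mult_right_mono powr_mono) auto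
        finally show ?case .
      qed
    qed
    show ?case
      using minkowski_dim_le[OF f Y _ _ *[OF _ elim(1)]] minkowski_dim_le[OF B Y _ _ *[OF _ elim(2)]] assms(2)
      by simp
  qed
qed

end
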